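(* Let $\mathcal M(A,B)\subset{}^d\mathcal K$ be maximal isotropic, and let $\mathsf k\in\mathbb C$ with $\operatorname{Im}\mathsf k\geq0$ and $\lambda=\mathsf k^2\in\mathbb R\setminus\{0\}$. Assume $\mathcal I\neq\emptyset$. Then $\lambda=\mathsf k^2$ with $\det(A+i\mathsf kB)\neq0$ is an eigenvalue of $-\Delta(\mathcal M(A,B),\underline a)$ with multiplicity $m$ if and only if $1$ is an eigenvalue of $\mathfrak S(\mathsf k;A,B)T(\mathsf k;\underline a)$ with geometric multiplicity $m$. If $\mathcal I=\emptyset$, then $\lambda=-\varkappa^2<0$ ($\varkappa>0$) is an eigenvalue of $-\Delta(\mathcal M(A,B))$ with multiplicity $m$ if and only if $0$ is an eigenvalue of $A-\varkappa B$ with geometric multiplicity $m$.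
   Context: Let $\mathcal G=(V,\mathcal I,\mathcal E,\partial)$ be a finite connected graph with internal edges $\mathcal I$ (intervals $I_i=[0,a_i]$, $a_i>0$, $\underline a=\{a_i\}$) and external edges $\mathcal E$ (half-lines $I_e=[0,\infty)$). $\mathcal H=\bigoplus_jL^2(I_j)$; $\mathcal D$ = $\psi\in\mathcal H$ with $\psi_j,\psi_j'$ absolutely continuous, $\psi_j''\in L^2$. $\mathcal K=\mathcal K_{\mathcal E}\oplus\mathcal K^{(-)}_{\mathcal I}\oplus\mathcal K^{(+)}_{\mathcal I}\cong\mathbb C^{|\mathcal E|}\oplus\mathbb C^{|\mathcal I|}\oplus\mathbb C^{|\mathcal I|}$, ${}^d\mathcal K=\mathcal K\oplus\mathcal K$. For $\psi\in\mathcal D$: $\underline\psi=(\{\psi_e(0)\},\{\psi_i(0)\},\{\psi_i(a_i)\})$, $\underline\psi'=(\{\psi_e'(0)\},\{\psi_i'(0)\},\{-\psi_i'(a_i)\})$. For linear $A,B:\mathcal K\to\mathcal K$ with $(A,B):{}^d\mathcal K\to\mathcal K$ of rank $|\mathcal E|+2|\mathcal I|$ and $AB^\dagger$ self-adjoint, $\mathcal M(A,B)=\{\chi_1\oplus\chi_2:A\chi_1+B\chi_2=0\}$ is maximal isotropic, and $\Delta(\mathcal M(A,B),\underline a)$ is the self-adjoint operator $(\Delta\psi)_j=\psi_j''$ on $\{\psi\in\mathcal D:A\underline\psi+B\underline\psi'=0\}$ (written $\Delta(\mathcal M(A,B))$ if $\mathcal I=\emptyset$). For $\det(A+i\mathsf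 kB)\neq0$, $\mathfrak S(\mathsf k;A,B)=-(A+i\mathsf kB)^{-1}(A-i\mathsf kB)$. With respect to $\mathcal K=\mathcal K_{\mathcal E}\oplus\mathcal K^{(-)}_{\mathcal I}\oplus\mathcal K^{(+)}_{\mathcal I}$, $T(\mathsf k;\underline a)=\begin{pmatrix}0&0&0\\0&0&e^{i\mathsf k\underline a}\\0&e^{i\mathsf k\underline a}&0\end{pmatrix}$, where $e^{i\mathsf k\underline a}$ is the diagonal $|\mathcal I|\times|\mathcal I|$ matrix with entries $e^{i\mathsf ka_i}$. *)

theory Defs
  imports "HOL-Analysis.Analysis" "Jordan_Normal_Form.Matrix_Kernel"
    "Jordan_Normal_Form.Determinant" "Jordan_Normal_Form.Schur_Decomposition"
    "Jordan_Normal_Form.Gauss_Jordan_Elimination" "Jordan_Normal_Form.DL_Rank"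
begin

text \<open>Indexing conventions. The graph has ne external edges and ni internal edges.
  Edges are indexed by natural numbers: j < ne are the external edges (half-lines [0,oo)),
  ne <= j < ne + ni are the internal edges, the internal edge j having length a (j - ne).
  The boundary space K = K_E + K_I^- + K_I^+ has dimension N = ne + 2 ni, indexed by
  k < ne (external edges at 0), ne <= k < ne+ni (internal edge k at 0) and
  ne+ni <= k < ne + 2 ni (internal edge k - ni at its endpoint a (k - ne - ni)).\<close>

definition edge_int :: "nat \<Rightarrow> (nat \<Rightarrow> real) \<Rightarrow> nat \<Rightarrow> real set" where
  "edge_int ne a j = (if j < ne then {0..} else {0 .. a (j - ne)})"

definition L2_on :: "(real \<Rightarrow> complex) \<Rightarrow> real set \<Rightarrow> bool" where
  "L2_on f S \<longleftrightarrow> f measurable_on S \<and> (\<lambda>x. (norm (f x))^2) integrable_on S"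

text \<open>f is (locally) absolutely continuous on the interval S (with left endpoint 0)
  with (almost everywhere) derivative g, i.e. f is the indefinite integral of the
  locally integrable function g.\<close>
definition ac_with_deriv :: "(real \<Rightarrow> complex) \<Rightarrow> (real \<Rightarrow> complex) \<Rightarrow> real set \<Rightarrow> bool" where
  "ac_with_deriv f g S \<longleftrightarrow>
     (\<forall>x\<in>S. g absolutely_integrable_on {0..x} \<and> f x = f 0 + integral {0..x} g)"

definition in_dom :: "nat \<Rightarrow> nat \<Rightarrow> (nat \<Rightarrow> real) \<Rightarrow> (nat \<Rightarrow> real \<Rightarrow> complex)
    \<Rightarrow> (nat \<Rightarrow> real \<Rightarrow> complex) \<Rightarrow> (nat \<Rightarrow> real \<Rightarrow> complex) \<Rightarrow> bool" where
  "in_dom ne ni a \<psi> \<psi>' \<psi>'' \<longleftrightarrow>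
     (\<forall>j < ne + ni. L2_on (\<psi> j) (edge_int ne a j) \<and> L2_on (\<psi>'' j) (edge_int ne a j) \<and>
        ac_with_deriv (\<psi> j) (\<psi>' j) (edge_int ne a j) \<and>
        ac_with_deriv (\<psi>' j) (\<psi>'' j) (edge_int ne a j))"

definition bvals :: "nat \<Rightarrow> nat \<Rightarrow> (nat \<Rightarrow> real) \<Rightarrow> (nat \<Rightarrow> real \<Rightarrow> complex) \<Rightarrow> complex vec" where
  "bvals ne ni a \<psi> = vec (ne + 2 * ni)
     (\<lambda>k. if k < ne + ni then \<psi> k 0 else \<psi> (k - ni) (a (k - ne - ni)))"

definition dvals :: "nat \<Rightarrow> nat \<Rightarrow> (nat \<Rightarrow> real) \<Rightarrow> (nat \<Rightarrow> real \<Rightarrow> complex) \<Rightarrow> complex vec" where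
  "dvals ne ni a \<psi>' = vec (ne + 2 * ni)
     (\<lambda>k. if k < ne + ni then \<psi>' k 0 else - \<psi>' (k - ni) (a (k - ne - ni)))"

text \<open>Eigenspace of -Delta(M(A,B), a) for the eigenvalue lam: solutions psi in the domain
  with A psi + B psi' = 0 and -psi'' = lam psi (as elements of L^2, i.e. a.e.).
  Elements of H are represented by functions vanishing outside the edges (this fixes the
  representative; all elements of D are continuous on the edges).\<close>
definition eigenspace :: "nat \<Rightarrow> nat \<Rightarrow> (nat \<Rightarrow> real) \<Rightarrow> complex mat \<Rightarrow> complex mat \<Rightarrow> complex
    \<Rightarrow> (nat \<Rightarrow> real \<Rightarrow> complex) set" where
  "eigenspace ne ni a A B lam = {\<psi>.
     (\<forall>j x. (ne + ni \<le> j \<or> x \<notin> edge_int ne a j) \<longrightarrow> \<psi> j x = 0) \<and>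
     (\<exists>\<psi>' \<psi>''. in_dom ne ni a \<psi> \<psi>' \<psi>'' \<and>
        A *\<^sub>v bvals ne ni a \<psi> + B *\<^sub>v dvals ne ni a \<psi>' = 0\<^sub>v (ne + 2 * ni) \<and>
        (\<forall>j < ne + ni. AE x in lebesgue_on (edge_int ne a j). - \<psi>'' j x = lam * \<psi> j x))}"

definition has_cdim :: "(nat \<Rightarrow> real \<Rightarrow> complex) set \<Rightarrow> nat \<Rightarrow> bool" where
  "has_cdim E m \<longleftrightarrow> (\<exists>fs. length fs = m \<and> set fs \<subseteq> E \<and>
     (\<forall>c. (\<forall>j x. (\<Sum>l<m. c l * (fs ! l) j x) = 0) \<longrightarrow> (\<forall>l<m. c l = 0)) \<and>
     (\<forall>\<psi>\<in>E. \<exists>c. \<psi> = (\<lambda>j x. \<Sum>l<m. c l * (fs ! l) j x)))"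

definition lap_eig_mult :: "nat \<Rightarrow> nat \<Rightarrow> (nat \<Rightarrow> real) \<Rightarrow> complex mat \<Rightarrow> complex mat \<Rightarrow> complex
    \<Rightarrow> nat \<Rightarrow> bool" where
  "lap_eig_mult ne ni a A B lam m \<longleftrightarrow> 0 < m \<and> has_cdim (eigenspace ne ni a A B lam) m"

definition geom_mult :: "complex mat \<Rightarrow> complex \<Rightarrow> nat \<Rightarrow> bool" where
  "geom_mult M mu m \<longleftrightarrow> 0 < m \<and> kernel_dim (M - mu \<cdot>\<^sub>m 1\<^sub>m (dim_row M)) = m"

definition Smat :: "complex \<Rightarrow> complex mat \<Rightarrow> complex mat \<Rightarrow> complex mat" where
  "Smat k A B = - (the (mat_inverse (A + (\<i> * k) \<cdot>\<^sub>m B)) * (A - (\<i> * k) \<cdot>\<^sub>m B))"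

definition Tmat :: "nat \<Rightarrow> nat \<Rightarrow> (nat \<Rightarrow> real) \<Rightarrow> complex \<Rightarrow> complex mat" where
  "Tmat ne ni a k = mat (ne + 2 * ni) (ne + 2 * ni) (\<lambda>(r, c).
     if ne \<le> r \<and> r < ne + ni \<and> c = r + ni then exp (\<i> * k * complex_of_real (a (r - ne)))
     else if ne + ni \<le> r \<and> r < ne + 2 * ni \<and> c = r - ni
       then exp (\<i> * k * complex_of_real (a (r - ne - ni)))
     else 0)"

definition ABmat :: "complex mat \<Rightarrow> complex mat \<Rightarrow> complex mat" where
  "ABmat A B = mat (dim_row A) (2 * dim_row A)
     (\<lambda>(r, c). if c < dim_row A then A $$ (r, c) else B $$ (r, c - dim_row A))"

end

theory Submission
  imports Defs
begin

text \<open>On each edge an eigenfunction is \<open>\<alpha> e\<^sup>i\<^sup>k\<^sup>x + \<beta> e\<^sup>-\<^sup>i\<^sup>k\<^sup>x\<close>. Collect in \<open>v\<close> the amplitudes of the waves leaving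
  the boundary points, an internal edge of length \<open>a\<close> carrying \<open>v\<^sub>- e\<^sup>i\<^sup>k\<^sup>x + v\<^sub>+ e\<^sup>i\<^sup>k\<^sup>(\<^sup>a\<^sup>-\<^sup>x\<^sup>)\<close>. Then the
  incoming amplitudes are \<open>T v\<close>, the boundary values are \<open>v + T v\<close> and the inward derivatives
  \<open>ik (v - T v)\<close>, so the boundary condition becomes \<open>(A + ikB) v + (A - ikB) T v = 0\<close>, that is
  \<open>S T v = v\<close>. Hence \<open>v \<mapsto> \<psi>\<close> maps \<open>ker (S T - 1)\<close> injectively into the solutions of the
  differential equation with the boundary conditions. Square integrability is automatic for
  \<open>Im k > 0\<close>. For real \<open>k\<close> it forces the external amplitudes to vanish, and so does \<open>S T v = v\<close>:
  \<open>S\<close> is unitary, while \<open>T\<close> preserves the norm of the internal components and kills the external ones.\<close>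

unbundle no vec_syntax \<comment> \<open>frees \<open>$\<close> for the vectors of Jordan_Normal_Form\<close>

subsection \<open>Dimension of function spaces parametrised by a matrix kernel\<close>

text \<open>Every summand of the Leibniz expansion contains a factor from row
  \<open>i\<close>.\<close>

lemma det_zero_row:
  fixes D :: "'a :: comm_ring_1 mat"
  assumes D: "D \<in> carrier_mat n n" and i: "i < n" and z: "\<And>j. j < n \<Longrightarrow> D $$ (i, j) = 0"
  shows "Determinant.det D = 0"
proof -
  have "(\<Prod>k = 0..<n. D $$ (k, p k)) = 0" if "p permutes {0..<n}" for p
    using permutes_in_image[OF that, of i] i z by (intro prod_zero bexI[of _ i]) auto
  then show ?thesis
    unfolding det_def'[OF D] by (intro sum.neutral) auto
qed

text \<open>\<open>has_cdim\<close> is a relation witnessed by lists, so uniqueness of the dimension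
  needs proof. Expressing \<open>m'\<close> independent elements through \<open>m < m'\<close>
  generators gives a coefficient matrix with a nontrivial kernel vector, which is a linear
  dependence.\<close>

lemma has_cdim_le:
  assumes "has_cdim E m" "has_cdim E m'"
  shows "m' \<le> m"
proof (rule ccontr)
  assume "\<not> m' \<le> m"
  hence mm: "m < m'" by simp
  obtain fs where fs: "length fs = m"
    "\<And>\<psi>. \<psi> \<in> E \<Longrightarrow> \<exists>c. \<psi> = (\<lambda>j x. \<Sum>l<m. c l * (fs ! l) j x)"
    using assms(1) unfolding has_cdim_def by auto
  obtain gs where gs: "length gs = m'" "set gs \<subseteq> E"
    "\<And>c. (\<And>j x. (\<Sum>l<m'. c l * (gs ! l) j x) = 0) \<Longrightarrow> \<forall>l<m'. c l = 0"
    using assms(2) unfolding has_cdim_def by auto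
  have "\<exists>c. p < m' \<longrightarrow> gs ! p = (\<lambda>j x. \<Sum>l<m. c l * (fs ! l) j x)" for p
    using fs(2)[of "gs ! p"] gs(1,2) nth_mem[of p gs] by blast
  hence "\<exists>C. \<forall>p. p < m' \<longrightarrow> gs ! p = (\<lambda>j x. \<Sum>l<m. C p l * (fs ! l) j x)"
    by (intro choice allI)
  then obtain C where C: "\<And>p. p < m' \<Longrightarrow> gs ! p = (\<lambda>j x. \<Sum>l<m. C p l * (fs ! l) j x)"
    by blast
  \<comment> \<open>Column \<open>j\<close> holds the coordinates of \<open>gs ! j\<close>. Padding
    with zero rows makes the matrix square, and row \<open>m\<close> is one of them, so the
    determinant vanishes.\<close>
  define D where "D = mat m' m' (\<lambda>(i, j). if i < m then C j i else 0)"
  have D: "D \<in> carrier_mat m' m'" by (simp add: D_def)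
  have "Determinant.det D = 0"
    by (rule det_zero_row[OF D mm]) (use mm in \<open>simp add: D_def\<close>)
  then obtain v where v: "v \<in> carrier_vec m'" "v \<noteq> 0\<^sub>v m'" "D *\<^sub>v v = 0\<^sub>v m'"
    using det_0_iff_vec_prod_zero[OF D] by auto
  have z: "(\<Sum>p<m'. C p l * v $ p) = 0" if "l < m" for l
  proof -
    have "(D *\<^sub>v v) $ l = 0" using v(3) that mm by simp
    thus ?thesis using that mm v(1)
      by (simp add: D_def scalar_prod_def lessThan_atLeast0)
  qed
  have "(\<Sum>p<m'. v $ p * (gs ! p) j x) = 0" for j x
  proof -
    have "(\<Sum>p<m'. v $ p * (gs ! p) j x) = (\<Sum>p<m'. \<Sum>l<m. v $ p * (C p l * (fs ! l) j x))"
      by (intro sum.cong refl) (simp add: C sum_distrib_left)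
    also have "\<dots> = (\<Sum>l<m. (\<Sum>p<m'. C p l * v $ p) * (fs ! l) j x)"
      by (subst sum.swap) (intro sum.cong refl, subst sum_distrib_right, simp only: mult_ac)
    also have "\<dots> = 0" by (simp add: z)
    finally show ?thesis .
  qed
  from gs(3)[OF this] have "v = 0\<^sub>v m'" using v(1) by (intro eq_vecI) auto
  with v(2) show False by simp
qed

text \<open>Translates the set-based notion of a basis into coefficient lists and coordinate sums,
  the form in which \<open>has_cdim\<close> speaks.\<close>

lemma mat_kernel_list_basis:
  fixes M :: "complex mat"
  assumes M: "M \<in> carrier_mat nr n"
  shows "\<exists>vs. length vs = kernel_dim M \<and> set vs \<subseteq> mat_kernel M \<and>
    (\<forall>c. (\<forall>i<n. (\<Sum>l<kernel_dim M. c l * (vs ! l) $ i) = 0) \<longrightarrow> (\<forall>l<kernel_dim M. c l = 0)) \<and>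
    (\<forall>v\<in>mat_kernel M. \<exists>c. \<forall>i<n. v $ i = (\<Sum>l<kernel_dim M. c l * (vs ! l) $ i))"
proof -
  interpret K: kernel nr n M by unfold_locales (rule M)
  obtain X where X: "finite X" "K.basis X" using kernel_basis_exists[OF M] by auto
  have Xk: "X \<subseteq> mat_kernel M" and indep: "\<not> K.lin_dep X" and spn: "K.span X = mat_kernel M"
    using X(2) unfolding K.Ker.basis_def by auto
  have card: "card X = kernel_dim M" using K.Ker.dim_basis[OF X] by simp
  obtain vs where vs: "set vs = X" "distinct vs" using finite_distinct_list[OF X(1)] by auto
  have len: "length vs = kernel_dim M" using vs card distinct_card[of vs] by simp
  have bij: "bij_betw (\<lambda>l. vs ! l) {..<kernel_dim M} X"
    using bij_betw_nth[OF vs(2), of "{..<kernel_dim M}" X] len vs(1) by simp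
  have sum_eq: "(\<Sum>x\<in>X. g x * x $ i) = (\<Sum>l<kernel_dim M. g (vs ! l) * (vs ! l) $ i)" for g i
    by (rule sum.reindex_bij_betw[OF bij, symmetric])
  show ?thesis
  proof (intro exI[of _ vs] conjI allI ballI impI len)
    show "set vs \<subseteq> mat_kernel M" using vs Xk by simp
  next
    fix c l assume c: "\<forall>i<n. (\<Sum>l<kernel_dim M. c l * (vs ! l) $ i) = 0" and l: "l < kernel_dim M"
    \<comment> \<open>Coefficients indexed by list position become a function on basis vectors; the
      position can be recovered because \<open>vs\<close> is distinct.\<close>
    define g where "g = (\<lambda>x. c (inv_into {..<kernel_dim M} (\<lambda>l. vs ! l) x))"
    have g: "g (vs ! l) = c l" if "l < kernel_dim M" for l
      unfolding g_def using bij that by (simp add: bij_betw_def inv_into_f_f)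
    have "K.lincomb g X = 0\<^sub>v n"
    proof (rule eq_vecI)
      show "dim_vec (K.lincomb g X) = dim_vec (0\<^sub>v n)"
        using K.Ker.lincomb_closed[OF Xk, of g] mat_kernel_carrier[OF M] by (metis PiE UNIV_I Pi_I carrier_vecD index_zero_vec(2) subsetD)
      fix i assume "i < dim_vec (0\<^sub>v n :: complex vec)"
      hence i: "i < n" by simp
      show "K.lincomb g X $ i = 0\<^sub>v n $ i"
        unfolding K.lincomb_index[OF i Xk] sum_eq using i c g by simp
    qed
    hence "g \<in> X \<rightarrow> {0}"
      using K.Ker.not_lindepD[OF indep X(1) subset_refl, of g] by simp
    moreover have "vs ! l \<in> X" using l vs(1) len nth_mem[of l vs] by simp
    ultimately have "g (vs ! l) = 0" by blast
    with g[OF l] show "c l = 0" by simp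
  next
    fix v assume "v \<in> mat_kernel M"
    hence "v \<in> K.span X" using spn by simp
    then obtain g where "v = K.lincomb g X"
      using K.Ker.finite_span[OF X(1) Xk] by auto
    hence "\<forall>i<n. v $ i = (\<Sum>l<kernel_dim M. g (vs ! l) * (vs ! l) $ i)"
      using K.lincomb_index[OF _ Xk] sum_eq by simp
    thus "\<exists>c. \<forall>i<n. v $ i = (\<Sum>l<kernel_dim M. c l * (vs ! l) $ i)"
      by (intro exI[of _ "\<lambda>l. g (vs ! l)"])
  qed
qed

text \<open>An injective linear map carries a basis of the kernel to a basis of the image. Linearity
  is expressed through fixed functions \<open>\<phi> i\<close>, since the target is a function space
  without a vector space structure declared on it. Uniqueness of \<open>m\<close> comes from
  \<open>has_cdim_le\<close>.\<close>

lemma has_cdim_image_mat_kernel: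
  fixes M :: "complex mat" and \<Phi> :: "complex vec \<Rightarrow> nat \<Rightarrow> real \<Rightarrow> complex"
  assumes M: "M \<in> carrier_mat nr n"
    and lin: "\<And>v j x. \<Phi> v j x = (\<Sum>i<n. v $ i * \<phi> i j x)"
    and inj: "\<And>v. v \<in> carrier_vec n \<Longrightarrow> (\<And>j x. \<Phi> v j x = 0) \<Longrightarrow> v = 0\<^sub>v n"
  shows "has_cdim (\<Phi> ` mat_kernel M) m \<longleftrightarrow> m = kernel_dim M"
proof -
  let ?d = "kernel_dim M"
  obtain vs where vs: "length vs = ?d" "set vs \<subseteq> mat_kernel M"
    "\<And>c l. \<forall>i<n. (\<Sum>l<?d. c l * (vs ! l) $ i) = 0 \<Longrightarrow> l < ?d \<Longrightarrow> c l = 0"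
    "\<And>v. v \<in> mat_kernel M \<Longrightarrow> \<exists>c. \<forall>i<n. v $ i = (\<Sum>l<?d. c l * (vs ! l) $ i)"
    using mat_kernel_list_basis[OF M] by blast
  have comb: "(\<Sum>l<?d. c l * (map \<Phi> vs ! l) j x) = (\<Sum>i<n. (\<Sum>l<?d. c l * (vs ! l) $ i) * \<phi> i j x)"
    for c j x
  proof -
    have "(\<Sum>l<?d. c l * (map \<Phi> vs ! l) j x) = (\<Sum>l<?d. \<Sum>i<n. c l * (vs ! l) $ i * \<phi> i j x)"
      by (intro sum.cong refl) (simp add: vs(1) lin sum_distrib_left mult.assoc)
    also have "\<dots> = (\<Sum>i<n. \<Sum>l<?d. c l * (vs ! l) $ i * \<phi> i j x)" by (rule sum.swap)
    finally show ?thesis by (simp add: sum_distrib_right)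
  qed
  have "has_cdim (\<Phi> ` mat_kernel M) ?d"
    unfolding has_cdim_def
  proof (intro exI[of _ "map \<Phi> vs"] conjI allI impI ballI)
    fix c l assume z: "\<forall>j x. (\<Sum>l<?d. c l * (map \<Phi> vs ! l) j x) = 0" and l: "l < ?d"
    define w where "w = vec n (\<lambda>i. \<Sum>l<?d. c l * (vs ! l) $ i)"
    have "\<Phi> w j x = 0" for j x using z unfolding comb lin by (simp add: w_def)
    hence "w = 0\<^sub>v n" by (intro inj) (auto simp: w_def)
    hence "(\<Sum>l<?d. c l * (vs ! l) $ i) = 0" if "i < n" for i

    proof -
      have "w $ i = 0" using \<open>w = 0\<^sub>v n\<close> that by simp
      thus ?thesis using that by (simp add: w_def)
    qed
    with l show "c l = 0" by (intro vs(3)) auto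
  next
    fix \<psi> assume "\<psi> \<in> \<Phi> ` mat_kernel M"
    then obtain v where v: "v \<in> mat_kernel M" "\<psi> = \<Phi> v" by auto
    obtain c where "\<forall>i<n. v $ i = (\<Sum>l<?d. c l * (vs ! l) $ i)" using vs(4)[OF v(1)] by auto
    hence "\<psi> = (\<lambda>j x. \<Sum>l<?d. c l * (map \<Phi> vs ! l) j x)"
      unfolding v(2) comb by (intro ext) (simp add: lin)
    thus "\<exists>c. \<psi> = (\<lambda>j x. \<Sum>l<?d. c l * (map \<Phi> vs ! l) j x)" by blast
  next
    show "length (map \<Phi> vs) = ?d" using vs(1) by simp
    show "set (map \<Phi> vs) \<subseteq> \<Phi> ` mat_kernel M" using vs(2) by auto
  qed
  thus ?thesis by (auto intro!: le_antisym elim: has_cdim_le)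
qed

subsection \<open>The equation \<open>-f'' = k\<^sup>2 f\<close> on an interval\<close>

lemma AE_lebesgue_on_negligible:
  assumes S: "S \<in> sets lebesgue" and "AE x in lebesgue_on S. P x"
  obtains N where "negligible N" "\<And>x. x \<in> S \<Longrightarrow> x \<notin> N \<Longrightarrow> P x"
proof -
  obtain N where N: "\<And>x. x \<in> space (lebesgue_on S) - N \<Longrightarrow> P x" "N \<in> null_sets (lebesgue_on S)"
    using AE_E3[OF assms(2)] by blast
  have "N \<in> null_sets lebesgue" using N(2) null_sets_restrict_space[OF S] by blast
  thus ?thesis using that[of N] N(1) by (auto simp: negligible_iff_null_sets)
qed

lemma has_vector_derivative_exp_mult_of_real:
  fixes c :: complex
  shows "((\<lambda>u. exp (c * complex_of_real u)) has_vector_derivative c * exp (c * complex_of_real y)) (at y within T)"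
proof -
  have "((\<lambda>z. exp (c * z)) has_field_derivative c * exp (c * complex_of_real y)) (at (complex_of_real y))"
    by (auto intro!: derivative_eq_intros)
  thus ?thesis by (rule has_vector_derivative_real_field)
qed

text \<open>Regularity comes first: \<open>f\<close> is an indefinite integral, hence continuous,
  and the equation, valid almost everywhere, then makes \<open>g\<close> continuously
  differentiable. The classical equation has two first integrals, one for each sign of ik, and these
  determine \<open>f x\<close> and \<open>g x\<close> linearly.\<close>

lemma helmholtz_ac_solution:
  fixes k :: complex
  assumes k: "k \<noteq> 0" and x: "x \<in> S" and S: "S \<in> sets lebesgue" "{0..x} \<subseteq> S" "0 \<le> x"
    and f: "ac_with_deriv f g S" and g: "ac_with_deriv g h S"
    and eq: "AE y in lebesgue_on S. - h y = k\<^sup>2 * f y"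
    and f0: "f 0 = \<alpha> + \<beta>" and g0: "g 0 = \<i> * k * (\<alpha> - \<beta>)"
  shows "f x = \<alpha> * exp (\<i> * k * x) + \<beta> * exp (- (\<i> * k * x))"
    and "g x = \<i> * k * (\<alpha> * exp (\<i> * k * x) - \<beta> * exp (- (\<i> * k * x)))"
proof -
  have gi: "g integrable_on {0..x}" and fx: "\<And>y. y \<in> {0..x} \<Longrightarrow> f y = f 0 + integral {0..y} g"
    using f x S(2) unfolding ac_with_deriv_def by (auto intro: set_lebesgue_integral_eq_integral(1))
  have hi: "h integrable_on {0..x}" and gx: "\<And>y. y \<in> {0..x} \<Longrightarrow> g y = g 0 + integral {0..y} h"
    using g x S(2) unfolding ac_with_deriv_def by (auto intro: set_lebesgue_integral_eq_integral(1))
  have fc: "continuous_on {0..x} f"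
    by (subst continuous_on_cong[OF refl fx]) (auto intro!: continuous_intros indefinite_integral_continuous_1 gi)
  have gc: "continuous_on {0..x} g"
    by (subst continuous_on_cong[OF refl gx]) (auto intro!: continuous_intros indefinite_integral_continuous_1 hi)
  obtain N where N: "negligible N" "\<And>y. y \<in> S \<Longrightarrow> y \<notin> N \<Longrightarrow> - h y = k\<^sup>2 * f y"
    using AE_lebesgue_on_negligible[OF S(1) eq] by blast
  \<comment> \<open>Changing \<open>h\<close> on a null set leaves its integral unchanged, so
    \<open>g\<close> is an indefinite integral of the continuous function -k^2 f.\<close>
  have gx': "g y = g 0 + integral {0..y} (\<lambda>t. - (k\<^sup>2 * f t))" if y: "y \<in> {0..x}" for y
  proof -
    have "integral {0..y} h = integral {0..y} (\<lambda>t. - (k\<^sup>2 * f t))"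
    proof (rule integral_spike[OF N(1)])
      fix t assume t: "t \<in> {0..y} - N"
      hence "t \<in> {0..x}" using y by simp
      hence "- h t = k\<^sup>2 * f t" using N(2)[of t] S(2) t by blast
      thus "- (k\<^sup>2 * f t) = h t" by (metis minus_minus)
    qed
    thus ?thesis using gx[OF y] by simp
  qed
  have fd: "(f has_vector_derivative g y) (at y within {0..x})" if y: "y \<in> {0..x}" for y
  proof (rule has_vector_derivative_transform[OF y])
    show "((\<lambda>u. f 0 + integral {0..u} g) has_vector_derivative g y) (at y within {0..x})"
      using integral_has_vector_derivative[OF gc y] by (auto intro!: derivative_eq_intros)
  qed (rule fx)
  have gd: "(g has_vector_derivative - (k\<^sup>2 * f y)) (at y within {0..x})" if y: "y \<in> {0..x}" for y
  proof (rule has_vector_derivative_transform[OF y])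
    have "continuous_on {0..x} (\<lambda>t. - (k\<^sup>2 * f t))" by (intro continuous_intros fc)
    from has_vector_derivative_add[OF has_vector_derivative_const integral_has_vector_derivative[OF this y], of "g 0"]
    show "((\<lambda>u. g 0 + integral {0..u} (\<lambda>t. - (k\<^sup>2 * f t))) has_vector_derivative - (k\<^sup>2 * f y)) (at y within {0..x})"
      by simp
  qed (rule gx')
  \<comment> \<open>For \<open>s = \<plusminus>ik\<close> the equation factors: \<open>g + s f\<close> solves \<open>u' = s u\<close>.\<close>
  have const: "(g x + s * f x) * exp (- s * x) = g 0 + s * f 0" if s: "s\<^sup>2 = - k\<^sup>2" for s
  proof -
    have "((\<lambda>u. (g u + s * f u) * exp (- s * complex_of_real u)) has_vector_derivative 0) (at y within {0..x})"
      if y: "y \<in> {0..x}" for y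
    proof -
      have "((\<lambda>u. (g u + s * f u) * exp (- s * complex_of_real u)) has_vector_derivative
         ((g y + s * f y) * (- s * exp (- s * complex_of_real y)) + (- (k\<^sup>2 * f y) + s * g y) * exp (- s * complex_of_real y))) (at y within {0..x})"
        by (intro has_vector_derivative_mult has_vector_derivative_add gd y has_vector_derivative_exp_mult_of_real has_vector_derivative_mult_right fd)
      also have "(g y + s * f y) * (- s * exp (- s * complex_of_real y)) + (- (k\<^sup>2 * f y) + s * g y) * exp (- s * complex_of_real y)
        = - (s\<^sup>2 + k\<^sup>2) * f y * exp (- s * complex_of_real y)"
        by (simp add: algebra_simps power2_eq_square)
      finally show ?thesis using s by simp
    qed
    from has_vector_derivative_zero_constant[OF convex_real_interval(5) this]
    obtain c where "\<And>y. y \<in> {0..x} \<Longrightarrow> (g y + s * f y) * exp (- s * complex_of_real y) = c" by blast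
    from this[of x] this[of 0] S(3) show ?thesis by simp
  qed
  \<comment> \<open>The first integral for s = ik has the initial value 2ik\<alpha>, the one for s =
    -ik has -2ik\<beta>. Their difference and sum give \<open>f x\<close> and
    \<open>g x\<close>.\<close>
  define e where "e = exp (\<i> * k * x)"
  have e: "e \<noteq> 0" "exp (- (\<i> * k * x)) = 1 / e" by (simp_all add: e_def exp_minus inverse_eq_divide)
  have "(g x + \<i> * k * f x) * (1 / e) = 2 * (\<i> * k * \<alpha>)"
    using const[of "\<i> * k"] e f0 g0 by (simp add: power_mult_distrib algebra_simps)
  hence p: "g x + \<i> * k * f x = 2 * (\<i> * k * \<alpha>) * e" using e by (simp add: field_simps)
  have "(g x - \<i> * k * f x) * e = - 2 * (\<i> * k * \<beta>)"
    using const[of "- (\<i> * k)"] f0 g0 by (simp add: power_mult_distrib e_def algebra_simps)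
  hence q: "g x - \<i> * k * f x = - 2 * (\<i> * k * \<beta>) * (1 / e)" using e by (simp add: field_simps)
  have "2 * (\<i> * k) * f x = (g x + \<i> * k * f x) - (g x - \<i> * k * f x)" by simp
  also have "\<dots> = 2 * (\<i> * k) * (\<alpha> * e + \<beta> * (1 / e))" unfolding p q by (simp add: algebra_simps)
  finally show "f x = \<alpha> * exp (\<i> * k * x) + \<beta> * exp (- (\<i> * k * x))"
    unfolding e(2) unfolding e_def[symmetric] using k by simp
  have "2 * g x = (g x + \<i> * k * f x) + (g x - \<i> * k * f x)" by simp
  also have "\<dots> = 2 * (\<i> * k * (\<alpha> * e - \<beta> * (1 / e)))" unfolding p q by (simp add: algebra_simps)
  finally show "g x = \<i> * k * (\<alpha> * exp (\<i> * k * x) - \<beta> * exp (- (\<i> * k * x)))"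
    unfolding e(2) unfolding e_def[symmetric] by simp
qed

text \<open>Eigenfunctions are cut off outside the edge, so they agree with the smooth
  \<open>F\<close> and \<open>G\<close> only on \<open>S\<close>. All integrals involved run over
  \<open>{0..x}\<close> inside \<open>S\<close>, where the fundamental theorem of calculus applies
  to \<open>F\<close>.\<close>

lemma ac_with_deriv_vector_derivative:
  assumes f: "\<And>x. x \<in> S \<Longrightarrow> f x = F x" "\<And>x. x \<in> S \<Longrightarrow> g x = G x"
    and F: "\<And>x T. (F has_vector_derivative G x) (at x within T)"
    and G: "continuous_on UNIV G"
    and S: "\<And>x. x \<in> S \<Longrightarrow> 0 \<le> x \<and> {0..x} \<subseteq> S"
  shows "ac_with_deriv f g S"
  unfolding ac_with_deriv_def
proof (intro ballI conjI)
  fix x assume x: "x \<in> S"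
  note Sx = S[OF x]
  have "G absolutely_integrable_on {0..x}"
    by (rule absolutely_integrable_continuous_real) (rule continuous_on_subset[OF G subset_UNIV])
  thus "g absolutely_integrable_on {0..x}"
    by (rule absolutely_integrable_spike[of _ _ "{}"]) (use f(2) Sx in auto)
  have "(G has_integral F x - F 0) {0..x}"
    by (rule fundamental_theorem_of_calculus) (use F Sx in auto)
  hence "(g has_integral F x - F 0) {0..x}"
    by (rule has_integral_spike[of "{}", rotated 2]) (use f(2) Sx in auto)
  moreover have "0 \<in> S" using Sx by auto
  ultimately show "f x = f 0 + integral {0..x} g" using f(1) x by (simp add: integral_unique)
qed

subsection \<open>Square integrability of plane waves\<close>

lemma L2_on_continuous:
  assumes f: "\<And>x. x \<in> S \<Longrightarrow> f x = F x" and F: "continuous_on UNIV F"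
    and S: "S \<in> sets lebesgue" and int: "(\<lambda>x. (norm (F x))\<^sup>2) integrable_on S"
  shows "L2_on f S"
  unfolding L2_on_def
proof
  have "F measurable_on S"
    using continuous_imp_measurable_on_sets_lebesgue[OF continuous_on_subset[OF F subset_UNIV] S] S
    by (simp add: measurable_on_iff_borel_measurable)
  moreover have "(\<lambda>x. if x \<in> S then f x else 0) = (\<lambda>x. if x \<in> S then F x else 0)"
    using f by auto
  ultimately show "f measurable_on S" using measurable_on_UNIV[of S f] measurable_on_UNIV[of S F] by simp
  show "(\<lambda>x. (norm (f x))\<^sup>2) integrable_on S"
    using int by (rule integrable_eq) (simp add: f)
qed

text \<open>Integrating the lower bound over an interval of length \<open>r\<close> beyond
  \<open>X\<close> gives c r on one side and at most twice the total integral of \<open>g\<close> on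
  the other, for every \<open>r\<close>. The shift \<open>p\<close> serves oscillating functions,
  whose square has no pointwise lower bound; \<open>p = 0\<close> serves growing ones.\<close>

lemma integrable_halfline_shift_sum_le_0:
  fixes g :: "real \<Rightarrow> real"
  assumes int: "g integrable_on {0..}" and nn: "\<And>x. 0 \<le> x \<Longrightarrow> 0 \<le> g x"
    and p: "0 \<le> p" and X: "0 \<le> X" and c: "\<And>x. X \<le> x \<Longrightarrow> c \<le> g x + g (x + p)"
  shows "c \<le> 0"
proof (rule ccontr)
  assume "\<not> c \<le> 0"
  hence c0: "0 < c" by simp
  define I where "I = integral {0..} g"
  have sub: "g integrable_on {u..v}" if "0 \<le> u" for u v
    using integrable_on_subinterval[OF int] that by auto
  have le: "integral {u..v} g \<le> I" if "0 \<le> u" for u v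
    unfolding I_def using that nn by (intro integral_subset_le sub int) auto
  have bound: "c * r \<le> 2 * I" if r: "0 \<le> r" for r
  proof -
    have sh: "((\<lambda>x. g (x + p)) has_integral integral {X + p..X + r + p} g) {X..X + r}"
      using has_integral_shift_real_ivl[OF integrable_integral[OF sub[of "X + p" "X + r + p"]], of p] X p by simp
    have "integral {X..X + r} (\<lambda>_. c) \<le> integral {X..X + r} (\<lambda>x. g x + g (x + p))"
      using sh X c by (intro integral_le integrable_add sub) auto
    also have "\<dots> = integral {X..X + r} g + integral {X + p..X + r + p} g"
      using integral_add[OF sub has_integral_integrable[OF sh]] X integral_unique[OF sh] by simp
    also have "\<dots> \<le> 2 * I" using le[of X "X + r"] le[of "X + p" "X + r + p"] X p by simp
    finally show ?thesis using r by (simp add: mult.commute)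
  qed
  have "0 \<le> I" using le[of 0 0] by simp
  \<comment> \<open>With this length, c r equals 2I + 1, which exceeds the bound 2I.\<close>
  thus False using bound[of "(2 * I + 1) / c"] c0 by (simp add: field_simps)
qed

text \<open>The imaginary part of k^2 is 2 Re k Im k. Only real and purely imaginary momenta
  therefore occur.\<close>

lemma Im_eq_0_or_Re_eq_0_if_square_real:
  assumes "k\<^sup>2 \<in> \<real>"
  shows "Im k = 0 \<or> Re k = 0"
  using assms by (auto simp: complex_is_Real_iff power2_eq_square)

text \<open>For real \<open>k\<close> neither wave decays, and the combination keeps a fixed mean
  square over a half period, so both amplitudes vanish. For Im k > 0 the \<beta> wave grows
  exponentially and eventually dominates the bounded \<alpha> wave.\<close>

lemma L2_on_halfline_exp_combination:
  fixes k :: complex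
  assumes k: "k \<noteq> 0" "0 \<le> Im k" "k\<^sup>2 \<in> \<real>" and f: "L2_on f {0..}"
    and eq: "\<And>x. 0 \<le> x \<Longrightarrow> f x = \<alpha> * exp (\<i> * k * complex_of_real x) + \<beta> * exp (- (\<i> * k * complex_of_real x))"
  shows "\<beta> = 0" and "Im k = 0 \<Longrightarrow> \<alpha> = 0"
proof -
  have int: "(\<lambda>x. (norm (f x))\<^sup>2) integrable_on {0..}" using f by (simp add: L2_on_def)
  have real_case: "\<alpha> = 0 \<and> \<beta> = 0" if im: "Im k = 0"
  proof -
    define t where "t = Re k"
    have t: "k = complex_of_real t" "t \<noteq> 0" using im k(1) by (auto simp: t_def complex_eq_iff)
    \<comment> \<open>Shifting by a quarter wavelength multiplies the two waves by \<open>\<plusminus>\<i>\<close> and \<open>\<mp>\<i>\<close>, so by the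
      parallelogram law \<open>|f x|\<^sup>2 + |f (x + p)|\<^sup>2\<close> is constant.\<close>
    define p where "p = pi / (2 * \<bar>t\<bar>)"
    define s where "s = exp (\<i> * k * complex_of_real p)"
    have s: "s\<^sup>2 = -1"
    proof -
      have "s\<^sup>2 = exp (\<i> * complex_of_real (2 * t * p))"
        unfolding s_def t(1) by (simp add: exp_double[symmetric] mult_ac)
      also have "2 * t * p = (if t > 0 then pi else - pi)" using t(2) by (simp add: p_def)
      finally show ?thesis by (auto simp: exp_minus split: if_splits)
    qed
    have "2 * ((norm \<alpha>)\<^sup>2 + (norm \<beta>)\<^sup>2) \<le> (norm (f x))\<^sup>2 + (norm (f (x + p)))\<^sup>2" if x: "0 \<le> x" for x
    proof -
      define e where "e = exp (\<i> * k * complex_of_real x)"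
      have en: "norm e = 1" and sn: "norm s = 1" by (simp_all add: e_def s_def t(1))
      have em: "exp (- (\<i> * k * complex_of_real x)) = 1 / e" by (simp add: e_def exp_minus inverse_eq_divide)
      have p0: "0 \<le> p" by (simp add: p_def)
      have se: "exp (\<i> * k * complex_of_real (x + p)) = e * s" by (simp add: e_def s_def exp_add ring_distribs)
      have s1: "1 / s = - s" using s sn by (subst nonzero_divide_eq_eq) (auto simp: power2_eq_square)
      have se': "exp (- (\<i> * k * complex_of_real (x + p))) = 1 / e * - s"
        unfolding exp_minus se s1[symmetric] by (simp add: field_simps)
      have "f (x + p) = s * (\<alpha> * e - \<beta> * (1 / e))"
        using eq[of "x + p"] x p0 unfolding se se' by (simp add: algebra_simps)
      hence "(norm (f x))\<^sup>2 + (norm (f (x + p)))\<^sup>2 = (norm (\<alpha> * e + \<beta> * (1 / e)))\<^sup>2 + (norm (\<alpha> * e - \<beta> * (1 / e)))\<^sup>2"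
        using eq[OF x] em sn by (simp add: norm_mult e_def[symmetric])
      also have "\<dots> = 2 * (norm (\<alpha> * e))\<^sup>2 + 2 * (norm (\<beta> * (1 / e)))\<^sup>2"
        by (simp add: cmod_power2) (simp add: power2_eq_square algebra_simps)
      finally show ?thesis using en by (simp add: norm_mult norm_divide)
    qed
    moreover have "0 \<le> p" by (simp add: p_def)
    ultimately have "2 * ((norm \<alpha>)\<^sup>2 + (norm \<beta>)\<^sup>2) \<le> 0"
      using integrable_halfline_shift_sum_le_0[OF int _ _ order_refl] by simp
    hence "(norm \<alpha>)\<^sup>2 + (norm \<beta>)\<^sup>2 \<le> 0"
      by (simp only: mult_le_0_iff) auto
    thus ?thesis using sum_power2_le_zero_iff[of "norm \<alpha>" "norm \<beta>"] by simp
  qed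
  thus "Im k = 0 \<Longrightarrow> \<alpha> = 0" by blast
  show "\<beta> = 0"
  proof (cases "Im k = 0")
    case False
    hence re: "Re k = 0" and im: "0 < Im k"
      using Im_eq_0_or_Re_eq_0_if_square_real[OF k(3)] k(2) by auto
    show ?thesis
    proof (rule ccontr)
      assume b: "\<beta> \<noteq> 0"
      \<comment> \<open>Chosen so that |\<beta>| Im k X = |\<alpha>| + 1. As exp y is at least y,
        the \<beta> wave then exceeds the \<alpha> wave by at least 1 beyond
        \<open>X\<close>.\<close>
      define X where "X = (norm \<alpha> + 1) / (norm \<beta> * Im k)"
      have X0: "0 \<le> X" using im by (simp add: X_def)
      have ge1: "1 \<le> (norm (f x))\<^sup>2" if x: "X \<le> x" for x
      proof -
        have n1: "norm (exp (\<i> * k * complex_of_real x)) \<le> 1" using im X0 x by (simp add: norm_exp_eq_Re)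
        have n2: "norm (exp (- (\<i> * k * complex_of_real x))) = exp (Im k * x)" by (simp add: norm_exp_eq_Re)
        have "norm \<alpha> + 1 = norm \<beta> * (Im k * X)" using b im by (simp add: X_def)
        also have "\<dots> \<le> norm \<beta> * exp (Im k * x)"
        proof (rule mult_left_mono)
          have "Im k * X \<le> Im k * x" using im x by simp
          also have "\<dots> \<le> exp (Im k * x)" using exp_ge_add_one_self[of "Im k * x"] by linarith
          finally show "Im k * X \<le> exp (Im k * x)" .
        qed simp
        also have "\<dots> = norm (\<beta> * exp (- (\<i> * k * complex_of_real x)))" by (simp add: norm_mult n2)
        also have "\<dots> \<le> norm (f x) + norm (\<alpha> * exp (\<i> * k * complex_of_real x))"
          using norm_triangle_ineq4[of "f x" "\<alpha> * exp (\<i> * k * complex_of_real x)"] eq[of x] X0 x by simp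
        also have "norm (\<alpha> * exp (\<i> * k * complex_of_real x)) \<le> norm \<alpha>"
          using mult_left_mono[OF n1, of "norm \<alpha>"] by (simp add: norm_mult)
        finally have "1 \<le> norm (f x)" by simp
        thus ?thesis by simp
      qed
      \<comment> \<open>The zero shift counts the same value twice, hence the constant 2.\<close>
      have "2 \<le> (norm (f x))\<^sup>2 + (norm (f (x + 0)))\<^sup>2" if "X \<le> x" for x
        using ge1[OF that] by simp
      from integrable_halfline_shift_sum_le_0[OF int _ order_refl X0 this] show False by simp
    qed
  qed (use real_case in blast)
qed

lemma L2_on_halfline_exp:
  fixes k :: complex
  assumes k: "0 < Im k" and f: "\<And>x. 0 \<le> x \<Longrightarrow> f x = \<alpha> * exp (\<i> * k * complex_of_real x)"
  shows "L2_on f {0..}"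
proof (rule L2_on_continuous)
  show "f x = \<alpha> * exp (\<i> * k * complex_of_real x)" if "x \<in> {0..}" for x using f that by simp
  have "(\<lambda>x. (norm \<alpha>)\<^sup>2 * exp (- (2 * Im k) * x)) integrable_on {0..}"
    by (intro integrable_on_mult_right integrable_on_exp_minus_to_infinity) (use k in simp)
  moreover have "(norm (\<alpha> * exp (\<i> * k * complex_of_real x)))\<^sup>2 = (norm \<alpha>)\<^sup>2 * exp (- (2 * Im k) * x)" for x
  proof -
    have "norm (exp (\<i> * k * complex_of_real x)) = exp (- Im k * x)" by (simp add: norm_exp_eq_Re)
    thus ?thesis by (simp add: norm_mult power_mult_distrib exp_double[symmetric] mult.assoc)
  qed
  ultimately show "(\<lambda>x. (norm (\<alpha> * exp (\<i> * k * complex_of_real x)))\<^sup>2) integrable_on {0..}" by (simp only:)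
  show "continuous_on UNIV (\<lambda>x. \<alpha> * exp (\<i> * k * complex_of_real x))" by (intro continuous_intros)
qed simp

subsection \<open>Unitarity of the scattering matrix at real momenta\<close>

lemma dim_mat_adjoint [simp]:
  "dim_row (mat_adjoint M) = dim_col M" "dim_col (mat_adjoint M) = dim_row M"
  by (auto simp: mat_adjoint_def)

lemma mat_adjoint_carrier:
  "M \<in> carrier_mat nr nc \<Longrightarrow> mat_adjoint M \<in> carrier_mat nc nr"
  by auto

lemma index_mat_adjoint [simp]:
  fixes M :: "complex mat"
  assumes "i < dim_col M" "j < dim_row M"
  shows "mat_adjoint M $$ (i, j) = cnj (M $$ (j, i))"
  using assms by (auto simp: mat_adjoint_def mat_of_rows_def)

lemma mat_adjoint_mult:
  fixes M N :: "complex mat"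
  assumes M: "M \<in> carrier_mat n m" and N: "N \<in> carrier_mat m l"
  shows "mat_adjoint (M * N) = mat_adjoint N * mat_adjoint M"
  using M N by (intro eq_matI) (auto simp: scalar_prod_def mult.commute)

lemma mat_adjoint_add:
  fixes M N :: "complex mat"
  assumes "M \<in> carrier_mat n m" "N \<in> carrier_mat n m"
  shows "mat_adjoint (M + N) = mat_adjoint M + mat_adjoint N"
  using assms by (intro eq_matI) auto

lemma mat_adjoint_smult:
  fixes M :: "complex mat"
  shows "mat_adjoint (c \<cdot>\<^sub>m M) = cnj c \<cdot>\<^sub>m mat_adjoint M"
  by (intro eq_matI) auto

text \<open>For a square matrix the right inverse is also a left inverse, so the columns of
  \<open>U\<close> are orthonormal, and this removes the mixed terms of the squared norm.\<close>

lemma unitary_mult_vec_norm: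
  fixes U :: "complex mat"
  assumes U: "U \<in> carrier_mat n n" and unit: "U * mat_adjoint U = 1\<^sub>m n" and w: "w \<in> carrier_vec n"
  shows "(\<Sum>i<n. (norm ((U *\<^sub>v w) $ i))\<^sup>2) = (\<Sum>i<n. (norm (w $ i))\<^sup>2)"
proof -
  note aU = mat_adjoint_carrier[OF U]
  have UU: "mat_adjoint U * U = 1\<^sub>m n" by (rule mat_mult_left_right_inverse[OF U aU unit])
  have orth: "(\<Sum>i<n. cnj (U $$ (i, j)) * U $$ (i, l)) = (if j = l then 1 else 0)"
    if j: "j < n" and l: "l < n" for j l
  proof -
    have "(mat_adjoint U * U) $$ (j, l) = (\<Sum>i<n. cnj (U $$ (i, j)) * U $$ (i, l))"
      using U j l by (simp add: scalar_prod_def lessThan_atLeast0)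
    thus ?thesis using j l by (simp add: UU)
  qed
  have Uw: "(U *\<^sub>v w) $ i = (\<Sum>l<n. U $$ (i, l) * w $ l)" if "i < n" for i
    using U w that by (simp add: scalar_prod_def lessThan_atLeast0)
  have "complex_of_real (\<Sum>i<n. (norm ((U *\<^sub>v w) $ i))\<^sup>2)
      = (\<Sum>i<n. cnj ((U *\<^sub>v w) $ i) * (U *\<^sub>v w) $ i)"
    by (simp only: of_real_sum complex_norm_square mult.commute)
  \<comment> \<open>The squared norm is expanded into a triple sum; the two swaps that follow bring
    the row index \<open>i\<close> innermost, where orthonormality evaluates the sum.\<close>
  also have "\<dots> = (\<Sum>i<n. \<Sum>j<n. \<Sum>l<n. cnj (w $ j) * w $ l * (cnj (U $$ (i, j)) * U $$ (i, l)))"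
    by (intro sum.cong refl) (simp add: Uw sum_product, simp add: mult_ac)
  also have "\<dots> = (\<Sum>j<n. \<Sum>i<n. \<Sum>l<n. cnj (w $ j) * w $ l * (cnj (U $$ (i, j)) * U $$ (i, l)))"
    by (rule sum.swap)
  also have "\<dots> = (\<Sum>j<n. \<Sum>l<n. \<Sum>i<n. cnj (w $ j) * w $ l * (cnj (U $$ (i, j)) * U $$ (i, l)))"
    by (intro sum.cong refl sum.swap)
  also have "\<dots> = (\<Sum>j<n. \<Sum>l<n. cnj (w $ j) * w $ l * (if j = l then 1 else 0))"
    by (intro sum.cong refl) (simp add: sum_distrib_left[symmetric] orth)
  also have "\<dots> = (\<Sum>j<n. cnj (w $ j) * w $ j)"
    by (intro sum.cong refl) (simp add: if_distrib[of "\<lambda>x. _ * x"] sum.delta cong: if_cong)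
  also have "\<dots> = complex_of_real (\<Sum>i<n. (norm (w $ i))\<^sup>2)"
    by (simp only: of_real_sum complex_norm_square mult.commute)
  finally show ?thesis by (simp only: of_real_eq_iff)
qed

text \<open>Write ^H for the adjoint. Self-adjointness of A B^H cancels the cross terms in P P^H and
  Q Q^H, leaving A A^H + t^2 B B^H for both. Hence the inverse of \<open>P\<close> times
  \<open>Q\<close> is unitary, and the boundary condition says that it maps \<open>w\<close> to
  -v.\<close>

lemma real_momentum_norm_eq:
  fixes A B :: "complex mat" and t :: real
  defines "k \<equiv> complex_of_real t"
  defines "P \<equiv> A + (\<i> * k) \<cdot>\<^sub>m B" and "Q \<equiv> A - (\<i> * k) \<cdot>\<^sub>m B"
  assumes A: "A \<in> carrier_mat n n" and B: "B \<in> carrier_mat n n"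
    and selfadj: "mat_adjoint (A * mat_adjoint B) = A * mat_adjoint B"
    and R: "R \<in> carrier_mat n n" "R * P = 1\<^sub>m n"
    and v: "v \<in> carrier_vec n" and w: "w \<in> carrier_vec n" and eq: "P *\<^sub>v v + Q *\<^sub>v w = 0\<^sub>v n"
  shows "(\<Sum>i<n. (norm (v $ i))\<^sup>2) = (\<Sum>i<n. (norm (w $ i))\<^sup>2)"
proof -
  note adj = mat_adjoint_carrier
  have P: "P \<in> carrier_mat n n" and Q: "Q \<in> carrier_mat n n" using A B by (auto simp: P_def Q_def)
  have BA: "B * mat_adjoint A = A * mat_adjoint B"
  proof -
    have "mat_adjoint (A * mat_adjoint B) = mat_adjoint (mat_adjoint B) * mat_adjoint A"
      by (rule mat_adjoint_mult[OF A adj[OF B]])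
    moreover have "mat_adjoint (mat_adjoint B) = B" by (intro eq_matI) auto
    ultimately show ?thesis using selfadj by simp
  qed
  have PP: "P * mat_adjoint P = Q * mat_adjoint Q"
  proof -
    \<comment> \<open>Both \<open>P\<close> and \<open>Q\<close> have the form A + c B with c = ik
      or c = -ik. Since k is real, c is purely imaginary, and c times its conjugate is the same in
      both cases.\<close>
    have Q': "Q = A + (- (\<i> * k)) \<cdot>\<^sub>m B" using A B unfolding Q_def by (intro eq_matI) auto
    have *: "(A + c \<cdot>\<^sub>m B) * mat_adjoint (A + c \<cdot>\<^sub>m B) = A * mat_adjoint A + (c * cnj c) \<cdot>\<^sub>m (B * mat_adjoint B)"
      if c: "cnj c = - c" for c
    proof -
      have "(A + c \<cdot>\<^sub>m B) * mat_adjoint (A + c \<cdot>\<^sub>m B)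
        = (A * mat_adjoint A + cnj c \<cdot>\<^sub>m (A * mat_adjoint B)) + (c \<cdot>\<^sub>m (B * mat_adjoint A) + c \<cdot>\<^sub>m (cnj c \<cdot>\<^sub>m (B * mat_adjoint B)))"
        unfolding mat_adjoint_add[OF A smult_carrier_mat[OF B]] mat_adjoint_smult
          add_mult_distrib_mat[OF A smult_carrier_mat[OF B] add_carrier_mat[OF smult_carrier_mat[OF adj[OF B]]]]
          mult_add_distrib_mat[OF A adj[OF A] smult_carrier_mat[OF adj[OF B]]]
          mult_add_distrib_mat[OF smult_carrier_mat[OF B] adj[OF A] smult_carrier_mat[OF adj[OF B]]]
          mult_smult_distrib[OF A adj[OF B]] mult_smult_assoc_mat[OF B adj[OF A]]
          mult_smult_assoc_mat[OF B smult_carrier_mat[OF adj[OF B]]] mult_smult_distrib[OF B adj[OF B]] ..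
      also have "\<dots> = A * mat_adjoint A + (c * cnj c) \<cdot>\<^sub>m (B * mat_adjoint B)"
        unfolding BA c using A B by (intro eq_matI) (auto simp: algebra_simps)
      finally show ?thesis .
    qed
    show ?thesis unfolding Q' P_def by (subst (1 2) *) (auto simp: k_def)
  qed
  have PR: "P * R = 1\<^sub>m n" by (rule mat_mult_left_right_inverse[OF R(1) P R(2)])
  define U where "U = R * Q"
  have U: "U \<in> carrier_mat n n" using R Q by (simp add: U_def)
  \<comment> \<open>Inside U U^H = R (Q Q^H) R^H the middle factor is exchanged for P P^H, which
    leaves (R P) (R P)^H = 1.\<close>
  have "U * mat_adjoint U = (R * Q) * (mat_adjoint Q * mat_adjoint R)"
    unfolding U_def by (subst mat_adjoint_mult[OF R(1) Q]) simp
  also have "\<dots> = R * ((Q * mat_adjoint Q) * mat_adjoint R)"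
    using R(1) Q adj[OF R(1)] adj[OF Q] by (simp add: assoc_mult_mat[of _ n n _ n _ n])
  also have "\<dots> = (R * P) * (mat_adjoint P * mat_adjoint R)"
    unfolding PP[symmetric] using R(1) P adj[OF R(1)] adj[OF P] by (simp add: assoc_mult_mat[of _ n n _ n _ n])
  also have "mat_adjoint P * mat_adjoint R = mat_adjoint (R * P)"
    by (rule mat_adjoint_mult[OF R(1) P, symmetric])
  also have "(R * P) * mat_adjoint (R * P) = 1\<^sub>m n"
    unfolding R(2) by (intro eq_matI) (auto simp: scalar_prod_def if_distrib cong: if_cong)
  finally have unit: "U * mat_adjoint U = 1\<^sub>m n" .
  have vw: "v = - (U *\<^sub>v w)"
  proof -
    have "R *\<^sub>v (P *\<^sub>v v + Q *\<^sub>v w) = 0\<^sub>v n"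
      unfolding eq using R(1) by (intro eq_vecI) (auto simp: scalar_prod_def)
    moreover have "R *\<^sub>v (P *\<^sub>v v + Q *\<^sub>v w) = R *\<^sub>v (P *\<^sub>v v) + R *\<^sub>v (Q *\<^sub>v w)"
      using R(1) P Q v w by (intro mult_add_distrib_mat_vec) auto
    moreover have "R *\<^sub>v (P *\<^sub>v v) = v"
      using assoc_mult_mat_vec[OF R(1) P v] R(2) v by simp
    moreover have "R *\<^sub>v (Q *\<^sub>v w) = U *\<^sub>v w"
      using assoc_mult_mat_vec[OF R(1) Q w] by (simp add: U_def)
    ultimately have "v + U *\<^sub>v w = 0\<^sub>v n" by simp
    hence "v $ i + (U *\<^sub>v w) $ i = 0" if "i < n" for i
      using that U by (simp add: index_add_vec(1)[symmetric] del: index_add_vec(1) index_mult_mat_vec)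
    thus ?thesis using v U by (intro eq_vecI) (auto simp: eq_neg_iff_add_eq_0)
  qed
  have "(\<Sum>i<n. (norm (v $ i))\<^sup>2) = (\<Sum>i<n. (norm ((U *\<^sub>v w) $ i))\<^sup>2)"
    unfolding vw using U by (intro sum.cong refl) simp
  thus ?thesis using unitary_mult_vec_norm[OF U unit w] by simp
qed

subsection \<open>Eigenfunctions as plane waves on the edges\<close>

text \<open>Coefficient of \<open>e\<^sup>-\<^sup>i\<^sup>k\<^sup>x\<close> on edge \<open>j\<close>: a wave leaving the far end \<open>x = a\<close> with amplitude \<open>v\<^sub>+\<close> is
  \<open>v\<^sub>+ e\<^sup>i\<^sup>k\<^sup>(\<^sup>a\<^sup>-\<^sup>x\<^sup>)\<close>.\<close>

definition reflected_coeff :: "nat \<Rightarrow> nat \<Rightarrow> (nat \<Rightarrow> real) \<Rightarrow> complex \<Rightarrow> complex vec \<Rightarrow> nat \<Rightarrow> complex" where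
  "reflected_coeff ne ni a k v j =
     (if j < ne then 0 else v $ (j + ni) * exp (\<i> * k * complex_of_real (a (j - ne))))"

definition plane_wave :: "complex \<Rightarrow> complex \<Rightarrow> complex \<Rightarrow> real \<Rightarrow> complex" where
  "plane_wave k \<alpha> \<beta> x = \<alpha> * exp (\<i> * k * complex_of_real x) + \<beta> * exp (- (\<i> * k * complex_of_real x))"

text \<open>The cut-off to zero selects the representative that \<open>eigenspace\<close>
  prescribes, so eigenfunctions can be compared as functions.\<close>

definition edge_wave :: "nat \<Rightarrow> nat \<Rightarrow> (nat \<Rightarrow> real) \<Rightarrow> complex \<Rightarrow> complex vec \<Rightarrow> nat \<Rightarrow> real \<Rightarrow> complex" where
  "edge_wave ne ni a k v j x = (if j < ne + ni \<and> x \<in> edge_int ne a j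
     then plane_wave k (v $ j) (reflected_coeff ne ni a k v j) x else 0)"

lemma plane_wave_0: "plane_wave k \<alpha> \<beta> 0 = \<alpha> + \<beta>"
  by (simp add: plane_wave_def)

lemma plane_wave_has_vector_derivative:
  "(plane_wave k \<alpha> \<beta> has_vector_derivative \<i> * k * plane_wave k \<alpha> (- \<beta>) x) (at x within S)"
proof -
  have "((\<lambda>x. \<alpha> * exp (\<i> * k * complex_of_real x) + \<beta> * exp (- (\<i> * k) * complex_of_real x)) has_vector_derivative
     \<alpha> * (\<i> * k * exp (\<i> * k * complex_of_real x)) + \<beta> * (- (\<i> * k) * exp (- (\<i> * k) * complex_of_real x))) (at x within S)"
    by (intro has_vector_derivative_add has_vector_derivative_mult_right has_vector_derivative_exp_mult_of_real)
  thus ?thesis by (simp add: plane_wave_def[abs_def] algebra_simps)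
qed

lemma plane_wave_deriv_has_vector_derivative:
  "((\<lambda>x. \<i> * k * plane_wave k \<alpha> (- \<beta>) x) has_vector_derivative - (k\<^sup>2 * plane_wave k \<alpha> \<beta> x)) (at x within S)"
  using has_vector_derivative_mult_right[OF plane_wave_has_vector_derivative[of k \<alpha> "- \<beta>" x S], of "\<i> * k"]
  by (simp add: power2_eq_square algebra_simps)

lemma continuous_on_plane_wave: "continuous_on S (plane_wave k \<alpha> \<beta>)"
  unfolding plane_wave_def[abs_def] by (intro continuous_intros)

text \<open>The value and the one-sided derivative at 0 give \<alpha> + \<beta> = 0 and, as k is
  nonzero, \<alpha> - \<beta> = 0.\<close>

lemma plane_wave_eq_0_on_interval:
  assumes k: "k \<noteq> 0" and b: "0 < b" and z: "\<And>x. x \<in> {0..b} \<Longrightarrow> plane_wave k \<alpha> \<beta> x = 0"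
  shows "\<alpha> = 0" "\<beta> = 0"
proof -
  have "((\<lambda>_. 0) has_vector_derivative \<i> * k * plane_wave k \<alpha> (- \<beta>) 0) (at 0 within {0..b})"
    by (rule has_vector_derivative_transform[OF _ _ plane_wave_has_vector_derivative[of k \<alpha> \<beta>]]) (use b z in auto)
  hence "\<i> * k * plane_wave k \<alpha> (- \<beta>) 0 = 0"
    using b by (intro vector_derivative_unique_within_closed_interval[of 0 b 0 "\<lambda>_. 0"]) (auto intro: derivative_intros)
  hence "\<alpha> - \<beta> = 0" using k by (simp add: plane_wave_0)
  moreover have "\<alpha> + \<beta> = 0" using z[of 0] b by (simp add: plane_wave_0)
  ultimately show "\<alpha> = 0" "\<beta> = 0" by (simp_all add: add_eq_0_iff)
qed

section \<open>The transit matrix T and the boundary data of plane waves\<close>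

lemma Tmat_carrier: "Tmat ne ni a k \<in> carrier_mat (ne + 2 * ni) (ne + 2 * ni)"
  by (simp add: Tmat_def)

lemma dim_Tmat [simp]:
  "dim_row (Tmat ne ni a k) = ne + 2 * ni" "dim_col (Tmat ne ni a k) = ne + 2 * ni"
  by (simp_all add: Tmat_def)

text \<open>Row \<open>i\<close> of \<open>T\<close> has at most one nonzero entry: what arrives at
  one end of an internal edge left the other end and picked up the transit factor e^(ika). Nothing
  arrives from infinity along an external edge.\<close>

lemma Tmat_mult_vec_index:
  assumes v: "v \<in> carrier_vec (ne + 2 * ni)" and i: "i < ne + 2 * ni"
  shows "(Tmat ne ni a k *\<^sub>v v) $ i =
    (if i < ne then 0
     else if i < ne + ni then exp (\<i> * k * complex_of_real (a (i - ne))) * v $ (i + ni)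
     else exp (\<i> * k * complex_of_real (a (i - ne - ni))) * v $ (i - ni))"
proof -
  have d: "dim_vec v = ne + 2 * ni" using v by simp
  have "(Tmat ne ni a k *\<^sub>v v) $ i = (\<Sum>c<ne + 2 * ni. (if ne \<le> i \<and> i < ne + ni \<and> c = i + ni
     then exp (\<i> * k * complex_of_real (a (i - ne)))
     else if ne + ni \<le> i \<and> i < ne + 2 * ni \<and> c = i - ni then exp (\<i> * k * complex_of_real (a (i - ne - ni))) else 0) * v $ c)"
    using i d by (simp add: Tmat_def scalar_prod_def lessThan_atLeast0)
  also have "\<dots> = (\<Sum>c<ne + 2 * ni. if c = (if i < ne + ni then i + ni else i - ni)
      then (if i < ne then 0
     else if i < ne + ni then exp (\<i> * k * complex_of_real (a (i - ne))) * v $ (i + ni)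
     else exp (\<i> * k * complex_of_real (a (i - ne - ni))) * v $ (i - ni)) else 0)"
    using i by (intro sum.cong refl) auto
  also have "\<dots> = (if i < ne then 0
     else if i < ne + ni then exp (\<i> * k * complex_of_real (a (i - ne))) * v $ (i + ni)
     else exp (\<i> * k * complex_of_real (a (i - ne - ni))) * v $ (i - ni))"
    using i by (subst sum.delta) auto
  finally show ?thesis .
qed

text \<open>At x = 0 the coefficient of e^(ikx) is the outgoing amplitude and the reflected
  coefficient is the incoming one. At x = a the two exchange roles, and the minus sign in
  \<open>dvals\<close> turns the derivative inward, so both ends obey the same formula.\<close>

lemma boundary_values_plane_wave:
  assumes v: "v \<in> carrier_vec (ne + 2 * ni)" and a: "\<forall>i<ni. 0 < a i"
    and \<psi>: "\<And>j x. j < ne + ni \<Longrightarrow> x \<in> edge_int ne a j \<Longrightarrow>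
        \<psi> j x = plane_wave k (v $ j) (reflected_coeff ne ni a k v j) x"
    and \<psi>': "\<And>j x. j < ne + ni \<Longrightarrow> x \<in> edge_int ne a j \<Longrightarrow>
        \<psi>' j x = \<i> * k * plane_wave k (v $ j) (- reflected_coeff ne ni a k v j) x"
  shows "bvals ne ni a \<psi> = v + Tmat ne ni a k *\<^sub>v v"
    and "dvals ne ni a \<psi>' = (\<i> * k) \<cdot>\<^sub>v (v - Tmat ne ni a k *\<^sub>v v)"
proof -
  let ?E = "\<lambda>j. exp (\<i> * k * complex_of_real (a j))"
  have e0: "0 \<in> edge_int ne a j" if "j < ne + ni" for j
    using that a by (cases "j < ne") (auto simp: edge_int_def less_imp_le)
  have ea: "a (j - ne) \<in> edge_int ne a j" if "j < ne + ni" "\<not> j < ne" for j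
    using that a by (auto simp: edge_int_def less_imp_le)
  \<comment> \<open>The factor e^(-ika) of the wave at the far end cancels the phase stored in the
    reflected coefficient. The sign \<open>s\<close> is 1 for the value and -1 for the
    derivative.\<close>
  have at_end: "plane_wave k (v $ (i - ni)) (s * (v $ i * ?E (i - ne - ni))) (a (i - ne - ni)) = v $ (i - ni) * ?E (i - ne - ni) + s * v $ i" for i s
    by (simp add: plane_wave_def exp_minus field_simps)
  have bnd: "bvals ne ni a \<psi> $ i = v $ i + (Tmat ne ni a k *\<^sub>v v) $ i"
       "dvals ne ni a \<psi>' $ i = \<i> * k * (v $ i - (Tmat ne ni a k *\<^sub>v v) $ i)" if i: "i < ne + 2 * ni" for i
  proof -
    have "bvals ne ni a \<psi> $ i = v $ i + (Tmat ne ni a k *\<^sub>v v) $ i \<and>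
       dvals ne ni a \<psi>' $ i = \<i> * k * (v $ i - (Tmat ne ni a k *\<^sub>v v) $ i)"
    proof (cases "i < ne + ni")
      case False
      define j where "j = i - ni"
      have j: "j < ne + ni" "\<not> j < ne" "j + ni = i" "j - ne = i - ne - ni" using False i by (auto simp: j_def)
      have r: "reflected_coeff ne ni a k v j = v $ i * ?E (i - ne - ni)"
        using j by (simp add: reflected_coeff_def)
      have "\<psi> j (a (i - ne - ni)) = v $ j * ?E (i - ne - ni) + v $ i"
        using \<psi>[OF j(1) ea[OF j(1,2)]] at_end[of i 1] by (simp add: r j_def[symmetric] j(4))
      moreover have "\<psi>' j (a (i - ne - ni)) = \<i> * k * (v $ j * ?E (i - ne - ni) - v $ i)"
        using \<psi>'[OF j(1) ea[OF j(1,2)]] at_end[of i "- 1"] by (simp add: r j_def[symmetric] j(4))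
      ultimately show ?thesis using False i
        by (simp add: bvals_def dvals_def Tmat_mult_vec_index[OF v i] j_def[symmetric] algebra_simps del: index_mult_mat_vec)
    next
      case True
      hence "reflected_coeff ne ni a k v i = (Tmat ne ni a k *\<^sub>v v) $ i"
        using i by (simp add: Tmat_mult_vec_index[OF v] reflected_coeff_def del: index_mult_mat_vec)
      thus ?thesis using True i \<psi>[OF True e0[OF True]] \<psi>'[OF True e0[OF True]]
        by (simp add: bvals_def dvals_def plane_wave_0 del: index_mult_mat_vec)
    qed
    thus "bvals ne ni a \<psi> $ i = v $ i + (Tmat ne ni a k *\<^sub>v v) $ i"
       "dvals ne ni a \<psi>' $ i = \<i> * k * (v $ i - (Tmat ne ni a k *\<^sub>v v) $ i)" by blast+
  qed
  have Tv: "Tmat ne ni a k *\<^sub>v v \<in> carrier_vec (ne + 2 * ni)"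
    using mult_mat_vec_carrier[OF Tmat_carrier v] .
  show "bvals ne ni a \<psi> = v + Tmat ne ni a k *\<^sub>v v"
  proof (rule eq_vecI)
    fix i assume "i < dim_vec (v + Tmat ne ni a k *\<^sub>v v)"
    hence i: "i < ne + 2 * ni" using Tv by (metis carrier_vecD index_add_vec(2))
    show "bvals ne ni a \<psi> $ i = (v + Tmat ne ni a k *\<^sub>v v) $ i"
      unfolding bnd(1)[OF i] using Tv i by (metis carrier_vecD index_add_vec(1))
  qed (use Tv in \<open>simp add: bvals_def\<close>)
  show "dvals ne ni a \<psi>' = (\<i> * k) \<cdot>\<^sub>v (v - Tmat ne ni a k *\<^sub>v v)"
  proof (rule eq_vecI)
    fix i assume "i < dim_vec ((\<i> * k) \<cdot>\<^sub>v (v - Tmat ne ni a k *\<^sub>v v))"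
    hence i: "i < ne + 2 * ni" using Tv by (metis carrier_vecD index_minus_vec(2) index_smult_vec(2))
    show "dvals ne ni a \<psi>' $ i = ((\<i> * k) \<cdot>\<^sub>v (v - Tmat ne ni a k *\<^sub>v v)) $ i"
      unfolding bnd(2)[OF i] using Tv i by (metis carrier_vecD index_minus_vec index_smult_vec(1))
  qed (use Tv in \<open>simp add: dvals_def\<close>)
qed

section \<open>The eigenspace in terms of amplitude vectors\<close>

lemma edge_int_sets_lebesgue: "edge_int ne a j \<in> sets lebesgue"
  by (simp add: edge_int_def)

lemma edge_int_initial: "x \<in> edge_int ne a j \<Longrightarrow> 0 \<le> x \<and> {0..x} \<subseteq> edge_int ne a j"
  by (auto simp: edge_int_def split: if_splits)

text \<open>Three situations: exponential decay on a half-line, the zero function on a half-line at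
  real momentum, and a continuous function on a compact interval.\<close>

lemma L2_on_edge_plane_wave:
  assumes k: "k \<noteq> 0" "0 \<le> Im k"
    and f: "\<And>x. x \<in> edge_int ne a j \<Longrightarrow> f x = plane_wave k \<alpha> \<beta> x"
    and ext: "j < ne \<Longrightarrow> \<beta> = 0 \<and> (Im k = 0 \<longrightarrow> \<alpha> = 0)"
  shows "L2_on f (edge_int ne a j)"
proof (cases "j < ne \<and> 0 < Im k")
  case True
  hence "L2_on f {0..}"
    using f ext by (intro L2_on_halfline_exp[of k f \<alpha>]) (auto simp: edge_int_def plane_wave_def)
  thus ?thesis using True by (simp add: edge_int_def)
next
  case False
  show ?thesis
  proof (rule L2_on_continuous[OF f continuous_on_plane_wave edge_int_sets_lebesgue])
    show "(\<lambda>x. (norm (plane_wave k \<alpha> \<beta> x))\<^sup>2) integrable_on edge_int ne a j"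
    proof (cases "j < ne")
      case True
      hence "\<alpha> = 0" "\<beta> = 0" using False ext k by auto
      thus ?thesis by (simp add: plane_wave_def integrable_0)
    next
      case False
      thus ?thesis
        by (auto simp: edge_int_def intro!: integrable_continuous_real continuous_intros continuous_on_plane_wave)
    qed
  qed
qed

lemma edge_wave_in_eigenspace:
  fixes k :: complex
  assumes a: "\<forall>i<ni. 0 < a i" and k: "k \<noteq> 0" "0 \<le> Im k"
    and v: "v \<in> carrier_vec (ne + 2 * ni)"
    and cond: "A *\<^sub>v (v + Tmat ne ni a k *\<^sub>v v) + B *\<^sub>v ((\<i> * k) \<cdot>\<^sub>v (v - Tmat ne ni a k *\<^sub>v v)) = 0\<^sub>v (ne + 2 * ni)"
    and ext: "Im k = 0 \<Longrightarrow> \<forall>j<ne. v $ j = 0"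
  shows "edge_wave ne ni a k v \<in> eigenspace ne ni a A B (k\<^sup>2)"
proof -
  define \<psi> where "\<psi> = edge_wave ne ni a k v"
  define r where "r = reflected_coeff ne ni a k v"
  define \<psi>' where "\<psi>' = (\<lambda>j x. \<i> * k * plane_wave k (v $ j) (- r j) x)"
  define \<psi>'' where "\<psi>'' = (\<lambda>j x. - (k\<^sup>2 * plane_wave k (v $ j) (r j) x))"
  have \<psi>_edge: "\<psi> j x = plane_wave k (v $ j) (r j) x" if "j < ne + ni" "x \<in> edge_int ne a j" for j x
    using that by (simp add: \<psi>_def edge_wave_def r_def)
  have r0: "r j = 0 \<and> (Im k = 0 \<longrightarrow> v $ j = 0)" if "j < ne" for j
    using that ext by (simp add: r_def reflected_coeff_def)
  have dom: "in_dom ne ni a \<psi> \<psi>' \<psi>''"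
    unfolding in_dom_def
  proof (intro allI impI conjI)
    fix j assume j: "j < ne + ni"
    show "L2_on (\<psi> j) (edge_int ne a j)"
      by (rule L2_on_edge_plane_wave[OF k(1,2) \<psi>_edge[OF j] r0])
    show "L2_on (\<psi>'' j) (edge_int ne a j)"
      \<comment> \<open>The second derivative is again a plane wave, with both coefficients
        multiplied by -k^2, so it satisfies the same vanishing conditions on external edges.\<close>
      by (rule L2_on_edge_plane_wave[OF k(1,2), where \<alpha> = "- (k\<^sup>2 * v $ j)" and \<beta> = "- (k\<^sup>2 * r j)"])
        (use r0[of j] in \<open>simp_all add: \<psi>''_def plane_wave_def algebra_simps\<close>)
    show "ac_with_deriv (\<psi> j) (\<psi>' j) (edge_int ne a j)"
      unfolding \<psi>'_def
      by (rule ac_with_deriv_vector_derivative[OF \<psi>_edge[OF j] refl plane_wave_has_vector_derivative _ edge_int_initial])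
        (assumption | intro continuous_intros continuous_on_plane_wave)+
    show "ac_with_deriv (\<psi>' j) (\<psi>'' j) (edge_int ne a j)"
      unfolding \<psi>'_def \<psi>''_def
      by (rule ac_with_deriv_vector_derivative[OF refl refl plane_wave_deriv_has_vector_derivative _ edge_int_initial])
        (assumption | intro continuous_intros continuous_on_plane_wave)+
  qed
  have bv: "bvals ne ni a \<psi> = v + Tmat ne ni a k *\<^sub>v v"
    "dvals ne ni a \<psi>' = (\<i> * k) \<cdot>\<^sub>v (v - Tmat ne ni a k *\<^sub>v v)"
    using \<psi>_edge by (intro boundary_values_plane_wave[OF v a, of \<psi> k \<psi>']; simp add: r_def \<psi>'_def)+
  have ae: "AE x in lebesgue_on (edge_int ne a j). - \<psi>'' j x = k\<^sup>2 * \<psi> j x" if "j < ne + ni" for j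
    using \<psi>_edge[OF that] by (intro AE_I2) (simp add: \<psi>''_def)
  have zero: "\<forall>j x. (ne + ni \<le> j \<or> x \<notin> edge_int ne a j) \<longrightarrow> \<psi> j x = 0"
    by (simp add: \<psi>_def edge_wave_def)
  have "\<psi> \<in> eigenspace ne ni a A B (k\<^sup>2)"
    unfolding eigenspace_def mem_Collect_eq
    by (intro conjI zero exI[of _ \<psi>'] exI[of _ \<psi>''] dom allI impI ae) (simp only: bv cond)
  thus ?thesis by (simp only: \<psi>_def)
qed

text \<open>Converse of \<open>edge_wave_in_eigenspace\<close>: the differential equation forces
  plane waves on every edge, and square integrability removes the inadmissible amplitudes on
  external edges.\<close>

lemma eigenspace_edge_waveE:
  fixes k :: complex
  assumes a: "\<forall>i<ni. 0 < a i" and k: "k \<noteq> 0" "0 \<le> Im k" "k\<^sup>2 \<in> \<real>"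
    and \<psi>: "\<psi> \<in> eigenspace ne ni a A B (k\<^sup>2)"
  obtains v where "v \<in> carrier_vec (ne + 2 * ni)" "\<psi> = edge_wave ne ni a k v"
    "A *\<^sub>v (v + Tmat ne ni a k *\<^sub>v v) + B *\<^sub>v ((\<i> * k) \<cdot>\<^sub>v (v - Tmat ne ni a k *\<^sub>v v)) = 0\<^sub>v (ne + 2 * ni)"
    "Im k = 0 \<longrightarrow> (\<forall>j<ne. v $ j = 0)"
proof -
  obtain \<psi>' \<psi>'' where zero: "\<And>j x. ne + ni \<le> j \<or> x \<notin> edge_int ne a j \<Longrightarrow> \<psi> j x = 0"
    and dom: "in_dom ne ni a \<psi> \<psi>' \<psi>''"
    and bc: "A *\<^sub>v bvals ne ni a \<psi> + B *\<^sub>v dvals ne ni a \<psi>' = 0\<^sub>v (ne + 2 * ni)"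
    and ae: "\<And>j. j < ne + ni \<Longrightarrow> AE x in lebesgue_on (edge_int ne a j). - \<psi>'' j x = k\<^sup>2 * \<psi> j x"
    using \<psi> unfolding eigenspace_def by blast
  \<comment> \<open>These coefficients solve \<psi>(0) = \<alpha> + \<beta> and \<psi>'(0) =
    ik(\<alpha> - \<beta>) on each edge.\<close>
  define \<alpha> where "\<alpha> = (\<lambda>j. (\<psi> j 0 + \<psi>' j 0 / (\<i> * k)) / 2)"
  define \<beta> where "\<beta> = (\<lambda>j. (\<psi> j 0 - \<psi>' j 0 / (\<i> * k)) / 2)"
  have sol: "\<psi> j x = plane_wave k (\<alpha> j) (\<beta> j) x" "\<psi>' j x = \<i> * k * plane_wave k (\<alpha> j) (- \<beta> j) x"
    if j: "j < ne + ni" and x: "x \<in> edge_int ne a j" for j x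
  proof -
    have ac: "ac_with_deriv (\<psi> j) (\<psi>' j) (edge_int ne a j)" "ac_with_deriv (\<psi>' j) (\<psi>'' j) (edge_int ne a j)"
      using dom j by (simp_all add: in_dom_def)
    have i: "\<psi> j 0 = \<alpha> j + \<beta> j" "\<psi>' j 0 = \<i> * k * (\<alpha> j - \<beta> j)"
      using k(1) by (simp_all add: \<alpha>_def \<beta>_def field_simps)
    note e = edge_int_initial[OF x]
    note sol = helmholtz_ac_solution[OF k(1) x edge_int_sets_lebesgue conjunct2[OF e] conjunct1[OF e] ac ae[OF j] i]
    show "\<psi> j x = plane_wave k (\<alpha> j) (\<beta> j) x" "\<psi>' j x = \<i> * k * plane_wave k (\<alpha> j) (- \<beta> j) x"
      using sol by (simp_all add: plane_wave_def)
  qed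
  have ext: "\<beta> j = 0" "Im k = 0 \<Longrightarrow> \<alpha> j = 0" if "j < ne" for j
  proof -
    have "L2_on (\<psi> j) (edge_int ne a j)" using dom that by (simp add: in_dom_def)
    hence L2: "L2_on (\<psi> j) {0..}" using that by (simp add: edge_int_def)
    have eq: "\<psi> j x = \<alpha> j * exp (\<i> * k * complex_of_real x) + \<beta> j * exp (- (\<i> * k * complex_of_real x))" if "0 \<le> x" for x
      using sol(1)[of j x] \<open>j < ne\<close> that by (simp add: edge_int_def plane_wave_def)
    show "\<beta> j = 0" by (rule L2_on_halfline_exp_combination(1)[OF k L2 eq])
    show "\<alpha> j = 0" if "Im k = 0" by (rule L2_on_halfline_exp_combination(2)[OF k L2 eq that])
  qed
  \<comment> \<open>At a far end the outgoing amplitude is recovered from \<beta> by undoing the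
    phase e^(ika) built into \<open>reflected_coeff\<close>.\<close>
  define v where "v = vec (ne + 2 * ni) (\<lambda>i. if i < ne + ni then \<alpha> i
    else \<beta> (i - ni) * exp (- (\<i> * k * complex_of_real (a (i - ne - ni)))))"
  have v: "v \<in> carrier_vec (ne + 2 * ni)" by (simp add: v_def)
  have vj: "v $ j = \<alpha> j" "reflected_coeff ne ni a k v j = \<beta> j" if "j < ne + ni" for j
  proof -
    show "v $ j = \<alpha> j" using that by (simp add: v_def)
    show "reflected_coeff ne ni a k v j = \<beta> j"
      using that ext(1)[of j] by (simp add: reflected_coeff_def v_def exp_minus)
  qed
  have bv: "bvals ne ni a \<psi> = v + Tmat ne ni a k *\<^sub>v v"
    "dvals ne ni a \<psi>' = (\<i> * k) \<cdot>\<^sub>v (v - Tmat ne ni a k *\<^sub>v v)"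
    using sol by (intro boundary_values_plane_wave[OF v a, of \<psi> k \<psi>']; simp add: vj)+
  have wave: "\<psi> j x = edge_wave ne ni a k v j x" for j x
    using zero[of j x] sol(1)[of j x] by (auto simp: edge_wave_def vj not_less)
  show ?thesis
  proof (rule that[OF v])
    show "\<psi> = edge_wave ne ni a k v" by (intro HOL.ext wave)
    show "A *\<^sub>v (v + Tmat ne ni a k *\<^sub>v v) + B *\<^sub>v ((\<i> * k) \<cdot>\<^sub>v (v - Tmat ne ni a k *\<^sub>v v)) = 0\<^sub>v (ne + 2 * ni)"
      using bc unfolding bv .
    show "Im k = 0 \<longrightarrow> (\<forall>j<ne. v $ j = 0)" using ext(2) by (simp add: vj)
  qed
qed

text \<open>Expansion over unit vectors, in the shape that \<open>has_cdim_image_mat_kernel\<close>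
  asks for.\<close>

lemma edge_wave_linear:
  "edge_wave ne ni a k v j x =
    (\<Sum>i<ne + 2 * ni. v $ i * edge_wave ne ni a k (unit_vec (ne + 2 * ni) i) j x)"
proof (cases "j < ne + ni \<and> x \<in> edge_int ne a j")
  case True
  let ?n = "ne + 2 * ni"
  have comp: "(\<Sum>i<?n. v $ i * unit_vec ?n i $ l) = v $ l" if "l < ?n" for l
  proof -
    have "(\<Sum>i<?n. v $ i * unit_vec ?n i $ l) = (\<Sum>i<?n. if i = l then v $ i else 0)"
      using that by (intro sum.cong refl) (auto simp: unit_vec_def)
    thus ?thesis using that by simp
  qed
  have refl_comp: "(\<Sum>i<?n. v $ i * reflected_coeff ne ni a k (unit_vec ?n i) j) = reflected_coeff ne ni a k v j"
    using True comp[of "j + ni"] by (simp add: reflected_coeff_def mult.assoc[symmetric] sum_distrib_right[symmetric])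
  show ?thesis using True
    by (simp add: edge_wave_def plane_wave_def ring_distribs sum.distrib mult.assoc[symmetric]
        sum_distrib_right[symmetric] comp refl_comp del: index_unit_vec)
qed (auto simp: edge_wave_def)

text \<open>An external edge carries a single wave, so its value at 0 is the amplitude. On an
  internal edge both coefficients vanish because the length is positive, and the phase in the
  reflected coefficient is never zero.\<close>

lemma edge_wave_eq_0:
  assumes a: "\<forall>i<ni. 0 < a i" and k: "k \<noteq> 0" and v: "v \<in> carrier_vec (ne + 2 * ni)"
    and z: "\<And>j x. edge_wave ne ni a k v j x = 0"
  shows "v = 0\<^sub>v (ne + 2 * ni)"
proof (rule eq_vecI)
  have pw: "plane_wave k (v $ j) (reflected_coeff ne ni a k v j) x = 0"
    if "j < ne + ni" "x \<in> edge_int ne a j" for j x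
    using z[of j x] that by (simp add: edge_wave_def)
  have int: "v $ j = 0" "v $ (j + ni) = 0" if j: "\<not> j < ne" "j < ne + ni" for j
  proof -
    have b: "0 < a (j - ne)" using a j by simp
    have z': "plane_wave k (v $ j) (reflected_coeff ne ni a k v j) x = 0" if "x \<in> {0..a (j - ne)}" for x
      using pw[OF j(2)] that j by (simp add: edge_int_def)
    show "v $ j = 0" using plane_wave_eq_0_on_interval(1)[OF k b z'] .
    have "reflected_coeff ne ni a k v j = 0" using plane_wave_eq_0_on_interval(2)[OF k b z'] .
    thus "v $ (j + ni) = 0" using j by (simp add: reflected_coeff_def)
  qed
  fix i assume "i < dim_vec (0\<^sub>v (ne + 2 * ni) :: complex vec)"
  hence i: "i < ne + 2 * ni" by simp
  consider "i < ne" | "\<not> i < ne" "i < ne + ni" | "\<not> i < ne + ni" by linarith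
  hence "v $ i = 0"
  proof cases
    case 1
    thus ?thesis using pw[of i 0] by (simp add: edge_int_def plane_wave_0 reflected_coeff_def)
  next
    case 2
    thus ?thesis by (rule int(1))
  next
    case 3
    thus ?thesis using int(2)[of "i - ni"] i by simp
  qed
  thus "v $ i = 0\<^sub>v (ne + 2 * ni) $ i" using i by simp
qed (use v in simp)

subsection \<open>The boundary condition as a kernel condition\<close>

lemma mat_inverse_det:
  fixes P :: "complex mat"
  assumes P: "P \<in> carrier_mat n n" and det: "Determinant.det P \<noteq> 0"
  obtains R where "mat_inverse P = Some R" "R \<in> carrier_mat n n" "R * P = 1\<^sub>m n" "P * R = 1\<^sub>m n"
proof (cases "mat_inverse P")
  case None
  have "P \<in> Units (ring_mat TYPE(complex) n ())" by (rule det_non_zero_imp_unit[OF P det])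
  thus ?thesis using mat_inverse(1)[OF P None, of "()"] by blast
next
  case (Some R)
  thus ?thesis using mat_inverse(2)[OF P Some] that by blast
qed

lemma smult_mat_mult_vec:
  fixes M :: "'a :: comm_ring_1 mat"
  assumes "M \<in> carrier_mat nr nc" "v \<in> carrier_vec nc"
  shows "(c \<cdot>\<^sub>m M) *\<^sub>v v = c \<cdot>\<^sub>v (M *\<^sub>v v)"
  using assms by (intro eq_vecI) (auto simp: scalar_prod_def sum_distrib_left mult.assoc)

text \<open>Regroups the boundary condition by outgoing \<open>v\<close> and incoming
  \<open>w\<close>; with c = ik this exhibits the two factors from which \<open>Smat\<close> is
  built.\<close>

lemma boundary_condition_in_out:
  fixes A B :: "complex mat"
  assumes A: "A \<in> carrier_mat n n" and B: "B \<in> carrier_mat n n"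
    and v: "v \<in> carrier_vec n" and w: "w \<in> carrier_vec n"
  shows "A *\<^sub>v (v + w) + B *\<^sub>v (c \<cdot>\<^sub>v (v - w)) = (A + c \<cdot>\<^sub>m B) *\<^sub>v v + (A - c \<cdot>\<^sub>m B) *\<^sub>v w"
proof -
  have "A *\<^sub>v (v + w) = A *\<^sub>v v + A *\<^sub>v w" by (rule mult_add_distrib_mat_vec[OF A v w])
  moreover have "B *\<^sub>v (c \<cdot>\<^sub>v (v - w)) = c \<cdot>\<^sub>v (B *\<^sub>v v - B *\<^sub>v w)"
    using B v w by (simp add: mult_mat_vec[of _ n n] mult_minus_distrib_mat_vec[of _ n n])
  moreover have "(A + c \<cdot>\<^sub>m B) *\<^sub>v v = A *\<^sub>v v + c \<cdot>\<^sub>v (B *\<^sub>v v)"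
    using A B v by (subst add_mult_distrib_mat_vec[of _ n n]) (auto simp: smult_mat_mult_vec)
  moreover have "(A - c \<cdot>\<^sub>m B) *\<^sub>v w = A *\<^sub>v w - c \<cdot>\<^sub>v (B *\<^sub>v w)"
    using A B w by (subst minus_mult_distrib_mat_vec[of _ n n]) (auto simp: smult_mat_mult_vec)
  ultimately show ?thesis
    using A B v w by (simp only:) (intro eq_vecI; simp add: algebra_simps del: index_mult_mat_vec)
qed

text \<open>Multiplication by the inverse of A + ikB is reversible and turns the condition into v -
  S T v = 0.\<close>

lemma in_out_iff_mat_kernel:
  fixes A B :: "complex mat"
  assumes A: "A \<in> carrier_mat n n" and B: "B \<in> carrier_mat n n" and T: "T \<in> carrier_mat n n"
    and det: "Determinant.det (A + (\<i> * k) \<cdot>\<^sub>m B) \<noteq> 0" and v: "v \<in> carrier_vec n"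
  shows "(A + (\<i> * k) \<cdot>\<^sub>m B) *\<^sub>v v + (A - (\<i> * k) \<cdot>\<^sub>m B) *\<^sub>v (T *\<^sub>v v) = 0\<^sub>v n \<longleftrightarrow>
    v \<in> mat_kernel (Smat k A B * T - 1 \<cdot>\<^sub>m 1\<^sub>m (dim_row (Smat k A B * T)))"
proof -
  let ?P = "A + (\<i> * k) \<cdot>\<^sub>m B" and ?Q = "A - (\<i> * k) \<cdot>\<^sub>m B"
  have P: "?P \<in> carrier_mat n n" and Q: "?Q \<in> carrier_mat n n" using A B by auto
  obtain R where R: "mat_inverse ?P = Some R" "R \<in> carrier_mat n n" "R * ?P = 1\<^sub>m n" "?P * R = 1\<^sub>m n"
    using mat_inverse_det[OF P det] by metis
  define w where "w = T *\<^sub>v v"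
  have w: "w \<in> carrier_vec n" using mult_mat_vec_carrier[OF T v] by (simp add: w_def)
  have S: "Smat k A B = - (R * ?Q)" by (simp add: Smat_def R(1))
  have Sc: "Smat k A B \<in> carrier_mat n n" using R Q by (simp add: S)
  \<comment> \<open>This vector is -S T v, so both sides of the equivalence amount to v + u =
    0.\<close>
  define u where "u = R *\<^sub>v (?Q *\<^sub>v w)"
  have Qw: "?Q *\<^sub>v w \<in> carrier_vec n" using mult_mat_vec_carrier[OF Q w] .
  have u: "u \<in> carrier_vec n" using mult_mat_vec_carrier[OF R(2) Qw] by (simp add: u_def)
  have "Smat k A B *\<^sub>v w = - u"
    unfolding S u_def assoc_mult_mat_vec[OF R(2) Q w, symmetric]
    by (rule uminus_mult_mat_vec) (use B w in simp)
  hence "(Smat k A B * T - 1 \<cdot>\<^sub>m 1\<^sub>m n) *\<^sub>v v = - u - v"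
    using Sc T v by (subst minus_mult_distrib_mat_vec[of _ n n]) (auto simp: w_def assoc_mult_mat_vec[OF Sc T v])
  moreover have "dim_row (Smat k A B * T) = n" using Sc by simp
  ultimately have ker: "v \<in> mat_kernel (Smat k A B * T - 1 \<cdot>\<^sub>m 1\<^sub>m (dim_row (Smat k A B * T))) \<longleftrightarrow> - u - v = 0\<^sub>v n"
    using v T Sc by (simp add: mat_kernel_def)
  have "?P *\<^sub>v v + ?Q *\<^sub>v w = 0\<^sub>v n \<longleftrightarrow> v + u = 0\<^sub>v n"
  proof
    assume "?P *\<^sub>v v + ?Q *\<^sub>v w = 0\<^sub>v n"
    hence "R *\<^sub>v (?P *\<^sub>v v + ?Q *\<^sub>v w) = R *\<^sub>v 0\<^sub>v n" by (rule arg_cong)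
    moreover have "R *\<^sub>v (?P *\<^sub>v v + ?Q *\<^sub>v w) = v + u"
      unfolding mult_add_distrib_mat_vec[OF R(2) mult_mat_vec_carrier[OF P v] Qw] u_def
        assoc_mult_mat_vec[OF R(2) P v, symmetric] R(3) using v by simp
    moreover have "R *\<^sub>v 0\<^sub>v n = 0\<^sub>v n" using R(2) by (intro eq_vecI) (auto simp: scalar_prod_def)
    ultimately show "v + u = 0\<^sub>v n" by simp
  next
    assume "v + u = 0\<^sub>v n"
    hence "?P *\<^sub>v (v + u) = ?P *\<^sub>v 0\<^sub>v n" by (rule arg_cong)
    moreover have "?P *\<^sub>v (v + u) = ?P *\<^sub>v v + ?Q *\<^sub>v w"
      unfolding mult_add_distrib_mat_vec[OF P v u] unfolding u_def
        assoc_mult_mat_vec[OF P R(2) Qw, symmetric] R(4) using Qw by simp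
    moreover have "?P *\<^sub>v 0\<^sub>v n = 0\<^sub>v n" using P by (intro eq_vecI) (auto simp: scalar_prod_def)
    ultimately show "?P *\<^sub>v v + ?Q *\<^sub>v w = 0\<^sub>v n" by simp
  qed
  also have "\<dots> \<longleftrightarrow> - u - v = 0\<^sub>v n"
    using u v by (auto simp: vec_eq_iff add_eq_0_iff) (metis minus_minus)
  finally show ?thesis unfolding ker w_def .
qed

text \<open>\<open>v\<close> and \<open>T v\<close> have equal norm by
  \<open>real_momentum_norm_eq\<close>. At real \<open>k\<close>, \<open>T\<close> only swaps the
  internal amplitudes in pairs with unimodular phases, so the internal sums cancel and the external
  squares add up to zero.\<close>

lemma real_momentum_external_zero:
  fixes A B :: "complex mat" and t :: real and a :: "nat \<Rightarrow> real" and ne ni :: nat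
  defines "k \<equiv> complex_of_real t" and "n \<equiv> ne + 2 * ni"
  assumes A: "A \<in> carrier_mat n n" and B: "B \<in> carrier_mat n n"
    and selfadj: "mat_adjoint (A * mat_adjoint B) = A * mat_adjoint B"
    and det: "Determinant.det (A + (\<i> * k) \<cdot>\<^sub>m B) \<noteq> 0"
    and v: "v \<in> carrier_vec n"
    and eq: "(A + (\<i> * k) \<cdot>\<^sub>m B) *\<^sub>v v + (A - (\<i> * k) \<cdot>\<^sub>m B) *\<^sub>v (Tmat ne ni a k *\<^sub>v v) = 0\<^sub>v n"
  shows "\<forall>j<ne. v $ j = 0"
proof -
  have P: "A + (\<i> * k) \<cdot>\<^sub>m B \<in> carrier_mat n n" using A B by auto
  obtain R where R: "R \<in> carrier_mat n n" "R * (A + (\<i> * k) \<cdot>\<^sub>m B) = 1\<^sub>m n"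
    using mat_inverse_det[OF P det] by metis
  define w where "w = Tmat ne ni a k *\<^sub>v v"
  have w: "w \<in> carrier_vec n" using mult_mat_vec_carrier[OF Tmat_carrier] v by (simp add: w_def n_def)
  have norm_eq: "(\<Sum>i<n. (norm (v $ i))\<^sup>2) = (\<Sum>i<n. (norm (w $ i))\<^sup>2)"
    by (rule real_momentum_norm_eq[OF A B selfadj R(1) _ v w, of t]) (use R eq in \<open>simp_all add: k_def w_def\<close>)
  have w_index: "norm (w $ i) = (if i < ne then 0 else if i < ne + ni then norm (v $ (i + ni)) else norm (v $ (i - ni)))"
    if "i < n" for i
    using Tmat_mult_vec_index[of v ne ni i a k] v that by (simp add: w_def n_def k_def norm_mult)
  \<comment> \<open>The three blocks are the external edges, the initial ends and the far ends of
    the internal edges.\<close>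
  have split: "(\<Sum>i<n. f i) = (\<Sum>i<ne. f i) + (\<Sum>i<ni. f (ne + i)) + (\<Sum>i<ni. f (ne + ni + i))"
    for f :: "nat \<Rightarrow> real"
  proof -
    have "(\<Sum>i<p + q. f i) = (\<Sum>i<p. f i) + (\<Sum>i<q. f (p + i))" for p q
      by (induction q) (simp_all add: add.assoc)
    thus ?thesis by (simp add: n_def mult_2 add.assoc[symmetric])
  qed
  have "(\<Sum>i<n. (norm (w $ i))\<^sup>2) = (\<Sum>i<ni. (norm (v $ (ne + ni + i)))\<^sup>2) + (\<Sum>i<ni. (norm (v $ (ne + i)))\<^sup>2)"
  proof -
    have "(\<Sum>i<ne. (norm (w $ i))\<^sup>2) = 0" by (simp add: w_index n_def)
    moreover have "(\<Sum>i<ni. (norm (w $ (ne + i)))\<^sup>2) = (\<Sum>i<ni. (norm (v $ (ne + ni + i)))\<^sup>2)"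
      by (intro sum.cong refl) (simp add: w_index n_def ac_simps)
    moreover have "(\<Sum>i<ni. (norm (w $ (ne + ni + i)))\<^sup>2) = (\<Sum>i<ni. (norm (v $ (ne + i)))\<^sup>2)"
      by (intro sum.cong refl) (simp add: w_index n_def)
    ultimately show ?thesis unfolding split by simp
  qed
  with norm_eq have "(\<Sum>i<ne. (norm (v $ i))\<^sup>2) = 0" unfolding split by linarith
  thus ?thesis by (simp add: sum_nonneg_eq_0_iff)
qed

text \<open>\<open>M\<close> stays abstract to cover both claims of the theorem: S T - 1 when A +
  ikB is invertible, and A - \<kappa>B, whose kernel is of interest exactly when it is
  singular.\<close>

lemma lap_eig_mult_iff_kernel_dim:
  fixes k :: complex and M :: "complex mat"
  assumes a: "\<forall>i<ni. 0 < a i" and k: "k \<noteq> 0" "0 \<le> Im k" "k\<^sup>2 \<in> \<real>"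
    and A: "A \<in> carrier_mat (ne + 2 * ni) (ne + 2 * ni)" and B: "B \<in> carrier_mat (ne + 2 * ni) (ne + 2 * ni)"
    and M: "M \<in> carrier_mat (ne + 2 * ni) (ne + 2 * ni)"
    and ker: "\<And>v. v \<in> carrier_vec (ne + 2 * ni) \<Longrightarrow> v \<in> mat_kernel M \<longleftrightarrow>
      (A + (\<i> * k) \<cdot>\<^sub>m B) *\<^sub>v v + (A - (\<i> * k) \<cdot>\<^sub>m B) *\<^sub>v (Tmat ne ni a k *\<^sub>v v) = 0\<^sub>v (ne + 2 * ni)"
    and ext: "\<And>v. v \<in> mat_kernel M \<Longrightarrow> Im k = 0 \<Longrightarrow> \<forall>j<ne. v $ j = 0"
  shows "lap_eig_mult ne ni a A B (k\<^sup>2) m \<longleftrightarrow> 0 < m \<and> kernel_dim M = m"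
proof -
  have bc: "A *\<^sub>v (v + Tmat ne ni a k *\<^sub>v v) + B *\<^sub>v ((\<i> * k) \<cdot>\<^sub>v (v - Tmat ne ni a k *\<^sub>v v)) = 0\<^sub>v (ne + 2 * ni)
      \<longleftrightarrow> v \<in> mat_kernel M" if v: "v \<in> carrier_vec (ne + 2 * ni)" for v
    unfolding boundary_condition_in_out[OF A B v mult_mat_vec_carrier[OF Tmat_carrier v]] ker[OF v] ..
  have "eigenspace ne ni a A B (k\<^sup>2) = edge_wave ne ni a k ` mat_kernel M"
  proof (intro equalityI subsetI)
    fix \<psi> assume "\<psi> \<in> eigenspace ne ni a A B (k\<^sup>2)"
    then obtain v where "v \<in> carrier_vec (ne + 2 * ni)" "\<psi> = edge_wave ne ni a k v"
      "A *\<^sub>v (v + Tmat ne ni a k *\<^sub>v v) + B *\<^sub>v ((\<i> * k) \<cdot>\<^sub>v (v - Tmat ne ni a k *\<^sub>v v)) = 0\<^sub>v (ne + 2 * ni)"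
      using eigenspace_edge_waveE[OF a k] by metis
    thus "\<psi> \<in> edge_wave ne ni a k ` mat_kernel M" using bc by blast
  next
    fix \<psi> assume "\<psi> \<in> edge_wave ne ni a k ` mat_kernel M"
    then obtain v where v: "v \<in> mat_kernel M" "\<psi> = edge_wave ne ni a k v" by blast
    have vc: "v \<in> carrier_vec (ne + 2 * ni)" using mat_kernelD(1)[OF M v(1)] .
    show "\<psi> \<in> eigenspace ne ni a A B (k\<^sup>2)"
      unfolding v(2) using v(1) by (intro edge_wave_in_eigenspace[OF a k(1,2) vc] ext) (simp_all only: bc[OF vc])
  qed
  moreover have "has_cdim (edge_wave ne ni a k ` mat_kernel M) m \<longleftrightarrow> m = kernel_dim M"
    by (rule has_cdim_image_mat_kernel[OF M edge_wave_linear edge_wave_eq_0[OF a k(1)]])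
  ultimately show ?thesis unfolding lap_eig_mult_def by auto
qed

theorem theorem3p2:
  fixes ne ni :: nat and a :: "nat \<Rightarrow> real" and A B :: "complex mat"
  assumes a_pos: "\<forall>i < ni. 0 < a i"
    and A_carr: "A \<in> carrier_mat (ne + 2 * ni) (ne + 2 * ni)"
    and B_carr: "B \<in> carrier_mat (ne + 2 * ni) (ne + 2 * ni)"
    and rank_AB: "vec_space.rank (ne + 2 * ni) (ABmat A B) = ne + 2 * ni"
    and selfadj: "mat_adjoint (A * mat_adjoint B) = A * mat_adjoint B"
  shows "(0 < ni \<longrightarrow>
            (\<forall>k m. 0 \<le> Im k \<longrightarrow> k^2 \<in> \<real> \<longrightarrow> k^2 \<noteq> 0 \<longrightarrow>
               Determinant.det (A + (\<i> * k) \<cdot>\<^sub>m B) \<noteq> 0 \<longrightarrow>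
               (lap_eig_mult ne ni a A B (k^2) m \<longleftrightarrow>
                geom_mult (Smat k A B * Tmat ne ni a k) 1 m)))
       \<and> (ni = 0 \<longrightarrow>
            (\<forall>(\<kappa>::real) m. 0 < \<kappa> \<longrightarrow>
               (lap_eig_mult ne ni a A B (- complex_of_real (\<kappa>^2)) m \<longleftrightarrow>
                geom_mult (A - complex_of_real \<kappa> \<cdot>\<^sub>m B) 0 m)))"
proof (intro conjI impI allI)
  let ?n = "ne + 2 * ni"
  fix k m
  assume k: "0 \<le> Im k" "k\<^sup>2 \<in> \<real>" "k\<^sup>2 \<noteq> 0" and det: "Determinant.det (A + (\<i> * k) \<cdot>\<^sub>m B) \<noteq> 0"
  let ?T = "Tmat ne ni a k" and ?ST = "Smat k A B * Tmat ne ni a k"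
  have ker: "v \<in> mat_kernel (?ST - 1 \<cdot>\<^sub>m 1\<^sub>m (dim_row ?ST)) \<longleftrightarrow>
      (A + (\<i> * k) \<cdot>\<^sub>m B) *\<^sub>v v + (A - (\<i> * k) \<cdot>\<^sub>m B) *\<^sub>v (?T *\<^sub>v v) = 0\<^sub>v ?n"
    if "v \<in> carrier_vec ?n" for v
    using in_out_iff_mat_kernel[OF A_carr B_carr Tmat_carrier det that] by simp
  have "A + (\<i> * k) \<cdot>\<^sub>m B \<in> carrier_mat ?n ?n" using A_carr B_carr by auto
  from mat_inverse_det[OF this det] obtain R
    where "mat_inverse (A + (\<i> * k) \<cdot>\<^sub>m B) = Some R" "R \<in> carrier_mat ?n ?n" by metis
  hence "dim_row ?ST = ?n" by (simp add: Smat_def)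
  hence M: "?ST - 1 \<cdot>\<^sub>m 1\<^sub>m (dim_row ?ST) \<in> carrier_mat ?n ?n" by auto
  have "lap_eig_mult ne ni a A B (k\<^sup>2) m \<longleftrightarrow> 0 < m \<and> kernel_dim (?ST - 1 \<cdot>\<^sub>m 1\<^sub>m (dim_row ?ST)) = m"
  proof (rule lap_eig_mult_iff_kernel_dim[OF a_pos _ k(1,2) A_carr B_carr M ker])
    show "k \<noteq> 0" using k(3) by auto
    fix v assume v: "v \<in> mat_kernel (?ST - 1 \<cdot>\<^sub>m 1\<^sub>m (dim_row ?ST))" and "Im k = 0"
    hence k_real: "k = complex_of_real (Re k)" by (simp add: complex_eq_iff)
    have vc: "v \<in> carrier_vec ?n" using mat_kernelD(1)[OF M v] .
    show "\<forall>j<ne. v $ j = 0"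
      using real_momentum_external_zero[OF A_carr B_carr selfadj, of "Re k" v a, folded k_real, OF det vc]
        ker[OF vc] v by blast
  qed
  thus "lap_eig_mult ne ni a A B (k^2) m \<longleftrightarrow> geom_mult ?ST 1 m" by (simp only: geom_mult_def)
next
  let ?n = "ne + 2 * ni"
  fix \<kappa> :: real and m
  assume ni: "ni = 0" and \<kappa>: "0 < \<kappa>"
  \<comment> \<open>With this momentum ik = -\<kappa>, so A + ikB becomes A - \<kappa>B, and k^2 =
    -\<kappa>^2. Its imaginary part \<kappa> is positive, so outgoing waves decay on every external
    edge.\<close>
  define k where "k = \<i> * complex_of_real \<kappa>"
  let ?P = "A - complex_of_real \<kappa> \<cdot>\<^sub>m B"
  have P: "?P \<in> carrier_mat ?n ?n" using A_carr B_carr by auto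
  have k: "k \<noteq> 0" "0 \<le> Im k" "k\<^sup>2 = - complex_of_real (\<kappa>\<^sup>2)"
    using \<kappa> by (simp_all add: k_def power_mult_distrib)
  have AkB: "A + (\<i> * k) \<cdot>\<^sub>m B = ?P"
    using A_carr B_carr by (intro eq_matI) (auto simp: k_def)
  have M: "?P - 0 \<cdot>\<^sub>m 1\<^sub>m (dim_row ?P) = ?P"
    using A_carr B_carr by (intro eq_matI) auto
  have "lap_eig_mult ne ni a A B (k\<^sup>2) m \<longleftrightarrow> 0 < m \<and> kernel_dim ?P = m"
  proof (rule lap_eig_mult_iff_kernel_dim[OF a_pos k(1,2) _ A_carr B_carr P])
    show "k\<^sup>2 \<in> \<real>" unfolding k(3) by simp
    show "\<forall>j<ne. v $ j = 0" if "Im k = 0" for v :: "complex vec"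
      using that \<kappa> by (simp add: k_def)
    fix v :: "complex vec" assume v: "v \<in> carrier_vec ?n"
    \<comment> \<open>Without internal edges nothing comes back to the vertex: the incoming term
      drops out and the boundary condition is (A - \<kappa>B) v = 0.\<close>
    have "Tmat ne ni a k *\<^sub>v v = 0\<^sub>v ?n"
      using Tmat_mult_vec_index[OF v] ni by (intro eq_vecI) (auto simp del: index_mult_mat_vec)
    moreover have "(A - (\<i> * k) \<cdot>\<^sub>m B) *\<^sub>v 0\<^sub>v ?n = 0\<^sub>v ?n"
      using A_carr B_carr by (intro eq_vecI) (auto simp: scalar_prod_def)
    moreover have "?P *\<^sub>v v \<in> carrier_vec ?n" using mult_mat_vec_carrier[OF P v] .
    ultimately show "v \<in> mat_kernel ?P \<longleftrightarrow>
      (A + (\<i> * k) \<cdot>\<^sub>m B) *\<^sub>v v + (A - (\<i> * k) \<cdot>\<^sub>m B) *\<^sub>v (Tmat ne ni a k *\<^sub>v v) = 0\<^sub>v ?n"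
      unfolding mat_kernel[OF P] AkB using v by simp
  qed
  thus "lap_eig_mult ne ni a A B (- complex_of_real (\<kappa>^2)) m \<longleftrightarrow> geom_mult ?P 0 m"
    by (simp only: geom_mult_def M k(3))
qed

end
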